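(* Assume that the mapping $F:\mathbb{R}^n\rightrightarrows\mathbb{R}^m$ is graphically Lipschitzian of dimension $n$ at $(\bar x,\bar y)\in\mathrm{gph}\,F$ and SCD-ss$^*$ around $(\bar x,\bar y)$. Then there is an open neighborhood $W$ of $(\bar x,\bar y)$ such that for almost all $(x,y)\in\mathrm{gph}\,F\cap W$ (with respect to the $n$-dimensional Hausdorff measure) the mapping $F$ is strictly proto-differentiable at $(x,y)$ and $\mathcal{S}F(x,y)$ is a singleton.
   Context: Multifunctions: $\mathrm{gph}\,F=\{(x,y) : y\in F(x)\}$. Graphically Lipschitzian: $F:\mathbb{R}^n\rightrightarrows\mathbb{R}^m$ is graphically Lipschitzian of dimension $d$ at $(\bar x,\bar y)\in\mathrm{gph}\,F$ if there is an open neighborhood $W$ of $(\bar x,\bar y)$ and a one-to-one mapping $\Phi$ from $W$ onto an open subset of $\mathbb{R}^{n+m}$ with $\Phi$ and $\Phi^{-1}$ continuously differentiable, such that $\Phi(\mathrm{gph}\,F\cap W)$ is the graph of a Lipschitz continuous mapping $f:U\to\mathbb{R}^{n+m-d}$, where $U\subset\mathbb{R}^d$ is open. SC derivative: $\mathcal{Z}_{n,m}$ is the metric space of all $n$-dimensional subspaces of $\mathbb{R}^{n+m}=\mathbb{R}^n\times\mathbb{R}^m$ with metric $d(L_1,L_2)=\|P_1-P_2\|$, $P_i$ the orthogonal projection matrix onto $L_i$. The tangent (Bouligand) cone is $T_\Omega(z)=\{w : \exists t_k\downarrow0,\ w_k\to w,\ z+t_kw_k\in\Omega\}$. $\mathcal{O}_F$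 is the set of $(x,y)\in\mathrm{gph}\,F$ with $T_{\mathrm{gph}\,F}(x,y)\in\mathcal{Z}_{n,m}$. Define $\mathcal{S}F(x,y)=\{L\in\mathcal{Z}_{n,m} : \exists (x_k,y_k)\in\mathcal{O}_F,\ (x_k,y_k)\to(x,y),\ d(L,T_{\mathrm{gph}\,F}(x_k,y_k))\to0\}$. For $L\in\mathcal{Z}_{n,m}$ the adjoint subspace is $L^*=\{(-v^*,u^* )\in\mathbb{R}^m\times\mathbb{R}^n : (u^*,v^* )\in L^\perp\}$, and $\mathcal{S}^*F(x,y)=\{L^* : L\in\mathcal{S}F(x,y)\}$, $(\bigcup\mathcal{S}^*F)(x,y)=\bigcup_{L^*\in\mathcal{S}^*F(x,y)}L^*$. SCD-ss$^*$: $F$ is SCD-ss$^*$ at $(\bar x,\bar y)\in\mathrm{gph}\,F$ if there is a neighborhood $N$ of $(\bar x,\bar y)$ such that $\mathcal{S}^*F(x,y)\neq\emptyset$ for all $(x,y)\in\mathrm{gph}\,F\cap N$, and for every $\epsilon>0$ there is $\delta>0$ such that $|\langle x^*,x-\bar x\rangle-\langle y^*,y-\bar y\rangle|\le\epsilon\|(x,y)-(\bar x,\bar y)\|\,\|(y^*,x^* )\|$ for all $(x,y)\in\mathrm{gph}\,F$ with $\|(x,y)-(\bar x,\bar y)\|\le\delta$ and all $(y^*,x^* )\in(\bigcup\mathcal{S}^*F)(x,y)$. It is SCD-ss$^*$ around $(\bar x,\bar y)$ if it is SCD-ss$^*$ at every $(x,y)\in\mathrm{gph}\,F$ sufficiently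 close to $(\bar x,\bar y)$. Strict proto-differentiability: $F$ is strictly proto-differentiable at $(\bar x,\bar y)\in\mathrm{gph}\,F$ if the Painlevé–Kuratowski upper and lower limits of the sets $(\mathrm{gph}\,F-(x,y))/t$, as $(x,y)\to(\bar x,\bar y)$ with $(x,y)\in\mathrm{gph}\,F$ and $t\downarrow0$, coincide. Here, for a family of sets $C_s$, the upper limit is $\{w : \liminf_{s\to\bar s}\mathrm{dist}(w,C_s)=0\}$ and the lower limit is $\{w : \limsup_{s\to\bar s}\mathrm{dist}(w,C_s)=0\}$. *)

theory Defs
  imports "HOL-Analysis.Analysis"
begin

text \<open>
  \<open>\<real>\<^sup>n \<times> \<real>\<^sup>m\<close> is the product type, whose library norm is the Euclidean one. Points \<open>(x, y)\<close> of a
  graph are treated as single elements \<open>z\<close> of the product.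
\<close>

definition gph :: "('a \<Rightarrow> 'b set) \<Rightarrow> ('a \<times> 'b) set" where
  "gph F = {(x, y). y \<in> F x}"


section \<open>Graphically Lipschitzian multifunctions\<close>

definition continuously_differentiable_on ::
  "('a::real_normed_vector \<Rightarrow> 'b::real_normed_vector) \<Rightarrow> 'a set \<Rightarrow> bool" where
  "continuously_differentiable_on f S \<longleftrightarrow>
     (\<exists>f' :: 'a \<Rightarrow> 'a \<Rightarrow>\<^sub>L 'b.
        (\<forall>x\<in>S. (f has_derivative blinfun_apply (f' x)) (at x)) \<and> continuous_on S f')"

text \<open>
  The dimension \<open>d\<close> is passed as a type: \<open>\<real>\<^sup>n\<^sup>+\<^sup>m\<close>, as the target of \<open>\<Phi>\<close>, is presented as
  \<open>\<real>\<^sup>d \<times> \<real>\<^sup>n\<^sup>+\<^sup>m\<^sup>-\<^sup>d\<close>, i.e. as \<open>'d \<times> 'e\<close> with \<open>d = DIM('d)\<close> and \<open>n + m - d = DIM('e)\<close>. As types have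
  positive dimension, this covers \<open>0 < d < n + m\<close>.
\<close>

definition graphically_lipschitzian ::
  "('d::euclidean_space \<times> 'e::euclidean_space) itself \<Rightarrow>
   ('a::euclidean_space \<Rightarrow> 'b::euclidean_space set) \<Rightarrow> 'a \<times> 'b \<Rightarrow> bool" where
  "graphically_lipschitzian _ F zbar \<longleftrightarrow>
     DIM('d) + DIM('e) = DIM('a) + DIM('b) \<and>
     zbar \<in> gph F \<and>
     (\<exists>W (\<Phi> :: 'a \<times> 'b \<Rightarrow> 'd \<times> 'e).
        open W \<and> zbar \<in> W \<and> inj_on \<Phi> W \<and> open (\<Phi> ` W) \<and>
        continuously_differentiable_on \<Phi> W \<and>
        continuously_differentiable_on (inv_into W \<Phi>) (\<Phi> ` W) \<and>
        (\<exists>U (f :: 'd \<Rightarrow> 'e) C.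
           open U \<and> C-lipschitz_on U f \<and> \<Phi> ` (gph F \<inter> W) = {(u, f u) |u. u \<in> U}))"


section \<open>The subspace containing derivative\<close>

definition Zspace :: "('a::euclidean_space \<times> 'b::euclidean_space) set set" where
  "Zspace = {L. subspace L \<and> dim L = DIM('a)}"

definition orth_projection :: "'c::euclidean_space set \<Rightarrow> 'c \<Rightarrow> 'c" where
  "orth_projection L z = (THE p. p \<in> L \<and> z - p \<in> L\<^sup>\<bottom>)"

definition subspace_dist :: "'c::euclidean_space set \<Rightarrow> 'c set \<Rightarrow> real" where
  "subspace_dist L1 L2 = onorm (\<lambda>z. orth_projection L1 z - orth_projection L2 z)"

definition tangent_cone :: "'c::real_normed_vector set \<Rightarrow> 'c \<Rightarrow> 'c set" where
  "tangent_cone \<Omega> z =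
     {w. \<exists>(t :: nat \<Rightarrow> real) w'.
           (\<forall>k. t k > 0) \<and> t \<longlonglongrightarrow> 0 \<and> w' \<longlonglongrightarrow> w \<and> (\<forall>k. z + t k *\<^sub>R w' k \<in> \<Omega>)}"

definition smooth_points ::
  "('a::euclidean_space \<Rightarrow> 'b::euclidean_space set) \<Rightarrow> ('a \<times> 'b) set" where
  "smooth_points F = {z \<in> gph F. tangent_cone (gph F) z \<in> Zspace}"

definition SC_derivative ::
  "('a::euclidean_space \<Rightarrow> 'b::euclidean_space set) \<Rightarrow> 'a \<times> 'b \<Rightarrow> ('a \<times> 'b) set set" where
  "SC_derivative F z =
     {L \<in> Zspace. \<exists>zk :: nat \<Rightarrow> 'a \<times> 'b.
        (\<forall>k. zk k \<in> smooth_points F) \<and> zk \<longlonglongrightarrow> z \<and>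
        (\<lambda>k. subspace_dist L (tangent_cone (gph F) (zk k))) \<longlonglongrightarrow> 0}"

definition adjoint_subspace ::
  "('a::euclidean_space \<times> 'b::euclidean_space) set \<Rightarrow> ('b \<times> 'a) set" where
  "adjoint_subspace L = {(- v, u) |u v. (u, v) \<in> L\<^sup>\<bottom>}"

definition SC_adjoint ::
  "('a::euclidean_space \<Rightarrow> 'b::euclidean_space set) \<Rightarrow> 'a \<times> 'b \<Rightarrow> ('b \<times> 'a) set set" where
  "SC_adjoint F z = adjoint_subspace ` SC_derivative F z"


section \<open>SCD semismooth* multifunctions\<close>

definition SCD_ss_star_at ::
  "('a::euclidean_space \<Rightarrow> 'b::euclidean_space set) \<Rightarrow> 'a \<times> 'b \<Rightarrow> bool" where
  "SCD_ss_star_at F zbar \<longleftrightarrow>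
     zbar \<in> gph F \<and>
     (\<exists>N. open N \<and> zbar \<in> N \<and> (\<forall>z \<in> gph F \<inter> N. SC_adjoint F z \<noteq> {})) \<and>
     (\<forall>\<epsilon>>0. \<exists>\<delta>>0. \<forall>(x, y) \<in> gph F. norm ((x, y) - zbar) \<le> \<delta> \<longrightarrow>
        (\<forall>(ys, xs) \<in> \<Union> (SC_adjoint F (x, y)).
           \<bar>xs \<bullet> (x - fst zbar) - ys \<bullet> (y - snd zbar)\<bar>
             \<le> \<epsilon> * norm ((x, y) - zbar) * norm (ys, xs)))"

definition SCD_ss_star_around ::
  "('a::euclidean_space \<Rightarrow> 'b::euclidean_space set) \<Rightarrow> 'a \<times> 'b \<Rightarrow> bool" where
  "SCD_ss_star_around F zbar \<longleftrightarrow>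
     zbar \<in> gph F \<and>
     (\<exists>N. open N \<and> zbar \<in> N \<and> (\<forall>z \<in> gph F \<inter> N. SCD_ss_star_at F z))"


section \<open>Strict proto-differentiability\<close>

text \<open>
  Painleve--Kuratowski limits of a family of sets along a filter. The library sets
  \<open>infdist w {} = 0\<close>, so these are the usual limits for families that are eventually nonempty;
  the difference quotients of a graph at points of that graph all contain \<open>0\<close>.
\<close>

definition PK_upper_limit :: "'s filter \<Rightarrow> ('s \<Rightarrow> 'c::metric_space set) \<Rightarrow> 'c set" where
  "PK_upper_limit G C = {w. Liminf G (\<lambda>s. ereal (infdist w (C s))) = 0}"

definition PK_lower_limit :: "'s filter \<Rightarrow> ('s \<Rightarrow> 'c::metric_space set) \<Rightarrow> 'c set" where
  "PK_lower_limit G C = {w. Limsup G (\<lambda>s. ereal (infdist w (C s))) = 0}"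

definition difference_quotient :: "'c::real_vector set \<Rightarrow> 'c \<times> real \<Rightarrow> 'c set" where
  "difference_quotient \<Omega> = (\<lambda>(z, t). (\<lambda>p. (p - z) /\<^sub>R t) ` \<Omega>)"

text \<open>
  The filter expresses \<open>z \<rightarrow> zbar\<close> with \<open>z \<in> gph F\<close> (the value \<open>z = zbar\<close> being allowed) and,
  jointly, \<open>t \<down> 0\<close>.
\<close>

definition strictly_proto_differentiable ::
  "('a::euclidean_space \<Rightarrow> 'b::euclidean_space set) \<Rightarrow> 'a \<times> 'b \<Rightarrow> bool" where
  "strictly_proto_differentiable F zbar \<longleftrightarrow>
     zbar \<in> gph F \<and>
     (let G = inf (nhds zbar) (principal (gph F)) \<times>\<^sub>F at_right 0
      in PK_upper_limit G (difference_quotient (gph F)) =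
         PK_lower_limit G (difference_quotient (gph F)))"


section \<open>Hausdorff measure\<close>

text \<open>
  The \<open>d\<close>-dimensional Hausdorff (outer) measure, normalised to agree with Lebesgue measure on
  \<open>\<real>\<^sup>d\<close>. Covering sets are required to be bounded because \<open>diameter\<close> is only meaningful for such
  sets; empty covering sets contribute \<open>0\<close> also for \<open>d = 0\<close>, where \<open>0 ^ 0 = 1\<close>.
\<close>

definition hausdorff_premeasure :: "nat \<Rightarrow> real \<Rightarrow> 'c::metric_space set \<Rightarrow> ennreal" where
  "hausdorff_premeasure d \<delta> A =
     (INF E \<in> {E :: nat \<Rightarrow> 'c set. A \<subseteq> (\<Union>i. E i) \<and> (\<forall>i. bounded (E i) \<and> diameter (E i) \<le> \<delta>)}.
        \<Sum>i. if E i = {} then 0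
             else ennreal (unit_ball_vol (real d) * (diameter (E i) / 2) ^ d))"

definition hausdorff_measure :: "nat \<Rightarrow> 'c::metric_space set \<Rightarrow> ennreal" where
  "hausdorff_measure d A = (SUP \<delta> \<in> {0<..}. hausdorff_premeasure d \<delta> A)"

end

theory Submission
  imports Defs
begin

text \<open>
  In the chart \<open>\<Phi>\<close> the graph of \<open>F\<close> is the graph of a Lipschitz map \<open>f\<close>, and every
  \<open>L \<in> \<S>F(z)\<close> becomes the graph of a linear map \<open>A\<close> with \<open>\<parallel>A\<parallel> \<le> C\<close>. Let \<open>B(u)\<close> be the set of these
  \<open>A\<close>. The map \<open>B\<close> is nonempty-valued, bounded and has closed graph, and the SCD-ss* property says that
  \<open>f(v) - f(u) - A (v - u) = o(\<parallel>v - u\<parallel>)\<close> uniformly in \<open>A \<in> B(v)\<close>, for every \<open>u\<close>.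

  Rademacher's theorem is not needed. On a line with direction \<open>e\<close>, two elements of \<open>B(v)\<close> agree on
  \<open>e\<close> up to \<open>o(1)\<close> as \<open>v\<close> tends to any point \<open>u\<close> of the line, because both match the same difference
  quotient of \<open>f\<close>. So the points of the line at which \<open>{A e | A \<in> B(v)}\<close> has diameter at least \<open>r\<close> do not
  accumulate and are countable, and by Tonelli \<open>B\<close> is single-valued almost everywhere.
  Where \<open>B(u) = {A}\<close>, all elements of \<open>B(v)\<close> are close to \<open>A\<close> for \<open>v\<close> near \<open>u\<close>, so \<open>f - A\<close> has small
  pointwise and hence small Lipschitz constant near \<open>u\<close>. Thus \<open>f\<close> is strictly differentiable at \<open>u\<close>,
  which makes \<open>F\<close> strictly proto-differentiable there.
\<close>

section \<open>Semismooth maps\<close>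

text \<open>Bisection along the segment from \<open>x\<close> to \<open>y\<close>: the estimate is
  additive over adjacent parameter intervals and holds on every short interval around a given point.
  The radius in \<open>loc\<close> may depend on \<open>z\<close>, which is all that semismoothness
  provides.\<close>

lemma pointwise_lipschitz_imp_norm_diff_le:
  fixes h :: "'a::real_normed_vector \<Rightarrow> 'b::real_normed_vector"
  assumes S: "convex S" "x \<in> S" "y \<in> S"
    and loc: "\<And>z. z \<in> S \<Longrightarrow> \<exists>d>0. \<forall>w\<in>S. norm (w - z) < d \<longrightarrow> norm (h w - h z) \<le> K * norm (w - z)"
  shows "norm (h y - h x) \<le> K * norm (y - x)"
proof -
  define p where "p t = x + t *\<^sub>R (y - x)" for t :: real
  have p_S: "p t \<in> S" if "0 \<le> t" "t \<le> 1" for t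
  proof -
    have "p t = (1 - t) *\<^sub>R x + t *\<^sub>R y"
      by (simp add: p_def algebra_simps)
    then show ?thesis
      using S that by (simp add: convexD)
  qed
  have p_diff: "norm (p t - p s) = \<bar>t - s\<bar> * norm (y - x)" for s t
  proof -
    have "p t - p s = (t - s) *\<^sub>R (y - x)"
      by (simp add: p_def algebra_simps)
    then show ?thesis by simp
  qed
  \<comment> \<open>The guard makes \<open>P\<close> vacuous outside the unit interval, since the
    bisection principle also tests short intervals that stick out of it.\<close>
  define P where "P s t \<longleftrightarrow> 0 \<le> s \<and> s \<le> t \<and> t \<le> 1 \<longrightarrow>
    norm (h (p t) - h (p s)) \<le> K * ((t - s) * norm (y - x))" for s t
  have "0 \<le> (1::real)"
    by simp
  then have "P 0 1"
  proof (induction rule: Bolzano)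
    case (trans a b c)
    show ?case
      unfolding P_def
    proof
      assume *: "0 \<le> a \<and> a \<le> c \<and> c \<le> 1"
      have "norm (h (p c) - h (p a)) \<le> norm (h (p c) - h (p b)) + norm (h (p b) - h (p a))"
        using norm_triangle_ineq[of "h (p c) - h (p b)" "h (p b) - h (p a)"] by simp
      also have "\<dots> \<le> K * ((c - b) * norm (y - x)) + K * ((b - a) * norm (y - x))"
        using trans * by (intro add_mono) (auto simp: P_def)
      finally show "norm (h (p c) - h (p a)) \<le> K * ((c - a) * norm (y - x))"
        by (simp add: algebra_simps)
    qed
  next
    case (local r)
    then obtain d where d: "d > 0"
      "\<And>w. w \<in> S \<Longrightarrow> norm (w - p r) < d \<Longrightarrow> norm (h w - h (p r)) \<le> K * norm (w - p r)"
      using loc p_S by meson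
    \<comment> \<open>The summand 1 keeps the denominator positive when
      \<open>x = y\<close>.\<close>
    define d' where "d' = d / (norm (y - x) + 1)"
    have "d' > 0"
      using d(1) by (auto simp: d'_def add_nonneg_pos)
    have near: "norm (h (p t) - h (p r)) \<le> K * (\<bar>t - r\<bar> * norm (y - x))"
      if "0 \<le> t" "t \<le> 1" "\<bar>t - r\<bar> < d'" for t
    proof -
      have "\<bar>t - r\<bar> * norm (y - x) \<le> \<bar>t - r\<bar> * (norm (y - x) + 1)"
        by (intro mult_left_mono) auto
      also have "\<dots> < d"
        using that(3) by (simp add: d'_def pos_less_divide_eq add_nonneg_pos)
      finally show ?thesis
        using d(2)[of "p t"] p_S that by (simp add: p_diff)
    qed
    \<comment> \<open>The bound \<open>near\<close> has its base point at \<open>r\<close>, so an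
      interval around \<open>r\<close> is split there.\<close>
    have "P a b" if "a \<le> r" "r \<le> b" "b - a < d'" for a b
      unfolding P_def
    proof
      assume *: "0 \<le> a \<and> a \<le> b \<and> b \<le> 1"
      have "norm (h (p b) - h (p a)) \<le> norm (h (p b) - h (p r)) + norm (h (p a) - h (p r))"
        by norm
      also have "\<dots> \<le> K * (\<bar>b - r\<bar> * norm (y - x)) + K * (\<bar>a - r\<bar> * norm (y - x))"
        using * that by (intro add_mono near) auto
      finally show "norm (h (p b) - h (p a)) \<le> K * ((b - a) * norm (y - x))"
        using that by (simp add: algebra_simps)
    qed
    then show ?case
      using \<open>d' > 0\<close> by blast
  qed
  then show ?thesis
    by (simp add: P_def p_def)
qed

section \<open>Null sets from countable slices\<close>

text \<open>Tonelli for the measures of the translates \<open>E - t e\<close>, \<open>t \<in> [0, 1]\<close>, which all equal that of \<open>E\<close>.\<close>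

lemma negligible_if_countable_on_lines:
  fixes E :: "'a::euclidean_space set" and e :: 'a
  assumes E: "E \<in> sets borel" and cnt: "\<And>x. countable {t::real. x + t *\<^sub>R e \<in> E}"
  shows "negligible E"
proof -
  let ?g = "\<lambda>(x, t). indicator {0..1::real} t * indicator E (x + t *\<^sub>R e) :: ennreal"
  have meas: "?g \<in> borel_measurable (lborel \<Otimes>\<^sub>M lborel)"
    using E by measurable
  have "(\<integral>\<^sup>+x. \<integral>\<^sup>+t. ?g (x, t) \<partial>lborel \<partial>lborel) = (\<integral>\<^sup>+t. \<integral>\<^sup>+x. ?g (x, t) \<partial>lborel \<partial>lborel)"
    using lborel_pair.Fubini[OF meas] by simp
  moreover have "(\<integral>\<^sup>+t. ?g (x, t) \<partial>lborel) = 0" for x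
  proof -
    have "emeasure lborel {t. x + t *\<^sub>R e \<in> E} = 0"
      using cnt[of x] by (simp add: emeasure_lborel_countable)
    moreover have "{t. x + t *\<^sub>R e \<in> E} \<in> sets lborel"
      using cnt[of x] by (simp add: sets.countable)
    ultimately have "AE t in lborel. t \<notin> {t. x + t *\<^sub>R e \<in> E}"
      by (intro AE_not_in) auto
    then have "AE t in lborel. ?g (x, t) = 0"
      by eventually_elim (auto simp: indicator_def)
    then show ?thesis
      by (subst nn_integral_cong_AE[where v = "\<lambda>_. 0"]) auto
  qed
  moreover have "(\<integral>\<^sup>+x. ?g (x, t) \<partial>lborel) = indicator {0..1} t * emeasure lborel E" for t
  proof -
    have "emeasure lborel E = emeasure (distr lborel borel ((+) (t *\<^sub>R e))) E"
      by (metis lborel_distr_plus)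
    also have "\<dots> = (\<integral>\<^sup>+x. indicator E x \<partial>distr lborel borel ((+) (t *\<^sub>R e)))"
      using E by simp
    also have "\<dots> = (\<integral>\<^sup>+x. indicator E (x + t *\<^sub>R e) \<partial>lborel)"
      using E by (subst nn_integral_distr) (auto simp: add.commute)
    finally show ?thesis
      using E by (simp add: nn_integral_cmult)
  qed
  ultimately have "(\<integral>\<^sup>+t. indicator {0..1::real} t * emeasure lborel E \<partial>lborel) = 0"
    by simp
  then have "emeasure lborel E = 0"
    by (simp add: nn_integral_multc)
  then show ?thesis
    using E by (simp add: negligible_iff_null_sets null_setsI null_sets_completionI)
qed

text \<open>Isolates what the chart argument needs of the limiting subspaces once they are written
  as linear maps. In \<open>semismooth\<close> the linear map is taken at the moving point
  \<open>v\<close>, not at the base point \<open>u\<close>, and \<delta> is uniform over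
  \<open>B v\<close> but may depend on \<open>u\<close>.\<close>

locale semismooth_selection =
  fixes U :: "'a::euclidean_space set" and f :: "'a \<Rightarrow> 'b::euclidean_space"
    and B :: "'a \<Rightarrow> ('a \<Rightarrow>\<^sub>L 'b) set" and C :: real
  assumes open_U: "open U"
    and nonempty: "u \<in> U \<Longrightarrow> B u \<noteq> {}"
    and bounded: "u \<in> U \<Longrightarrow> A \<in> B u \<Longrightarrow> norm A \<le> C"
    and closed_graph: "(\<And>k. v k \<in> U) \<Longrightarrow> v \<longlonglongrightarrow> u \<Longrightarrow> u \<in> U \<Longrightarrow>
      (\<And>k. G k \<in> B (v k)) \<Longrightarrow> G \<longlonglongrightarrow> A \<Longrightarrow> A \<in> B u"
    and semismooth: "u \<in> U \<Longrightarrow> 0 < \<epsilon> \<Longrightarrow> \<exists>\<delta>>0. \<forall>v\<in>U. norm (v - u) < \<delta> \<longrightarrow>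
      (\<forall>A\<in>B v. norm (f v - f u - A (v - u)) \<le> \<epsilon> * norm (v - u))"
begin

section \<open>Compactness and strict differentiability at single-valued points\<close>

lemma convergent_subsequence:
  assumes "\<And>k. v k \<in> U" "v \<longlonglongrightarrow> u" "u \<in> U" "\<And>k. G k \<in> B (v k)"
  obtains A r where "A \<in> B u" "strict_mono (r :: nat \<Rightarrow> nat)" "(G \<circ> r) \<longlonglongrightarrow> A"
proof -
  \<comment> \<open>The space of linear maps is finite-dimensional, so this ball is compact; the
    closed graph then places the limit in \<open>B u\<close>.\<close>
  have "G k \<in> cball 0 C" for k
    using bounded assms by auto
  then obtain A r where *: "strict_mono (r :: nat \<Rightarrow> nat)" "(G \<circ> r) \<longlonglongrightarrow> A"
    using compact_cball[of "0 :: 'a \<Rightarrow>\<^sub>L 'b" C] unfolding compact_def by metis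
  moreover have "A \<in> B u"
    using assms * LIMSEQ_subseq_LIMSEQ[OF assms(2) *(1)]
    by (intro closed_graph[of "v \<circ> r" u "G \<circ> r"]) auto
  ultimately show thesis
    using that by blast
qed

text \<open>Otherwise a sequence of elements of \<open>B (v k)\<close> with \<open>v k\<close>
  tending to \<open>u\<close> would stay \<epsilon> away from \<open>A\<close>, although some
  subsequence converges to an element of \<open>B u\<close>, that is, to \<open>A\<close>.\<close>

lemma upper_semicontinuous_at_singleton:
  assumes u: "u \<in> U" "B u = {A}" and "0 < \<epsilon>"
  shows "\<exists>\<delta>>0. \<forall>v\<in>U. norm (v - u) < \<delta> \<longrightarrow> (\<forall>A'\<in>B v. norm (A' - A) < \<epsilon>)"
proof (rule ccontr)
  assume "\<not> ?thesis"
  then have "\<exists>v A'. v \<in> U \<and> norm (v - u) < inverse (real (Suc k)) \<and> A' \<in> B v \<and> \<not> norm (A' - A) < \<epsilon>" for k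
    by (metis inverse_positive_iff_positive of_nat_0_less_iff zero_less_Suc)
  then obtain v G where v: "\<And>k. v k \<in> U" "\<And>k. norm (v k - u) < inverse (real (Suc k))"
    and G: "\<And>k. G k \<in> B (v k)" "\<And>k. \<epsilon> \<le> norm (G k - A)"
    by (metis not_less)
  have "(\<lambda>k. v k - u) \<longlonglongrightarrow> 0"
    using v(2) by (intro Lim_null_comparison[OF _ LIMSEQ_inverse_real_of_nat]) (auto intro: always_eventually less_imp_le)
  then have "v \<longlonglongrightarrow> u"
    by (simp add: LIM_zero_iff)
  then obtain r where "(G \<circ> r) \<longlonglongrightarrow> A"
    using convergent_subsequence v(1) u G(1) by (metis singletonD)
  then have "(\<lambda>k. norm ((G \<circ> r) k - A)) \<longlonglongrightarrow> norm (A - A)"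
    by (intro tendsto_intros)
  then have "\<epsilon> \<le> norm (A - A)"
    by (rule LIMSEQ_le_const) (use G in auto)
  then show False
    using \<open>0 < \<epsilon>\<close> by simp
qed

text \<open>Near \<open>u\<close> every element of \<open>B y\<close> is within \<epsilon>/2 of
  \<open>A\<close>. Semismoothness at each nearby \<open>z\<close> therefore bounds the pointwise
  Lipschitz constant of \<open>f - A\<close> at \<open>z\<close> by \<epsilon>, and on a convex ball
  a pointwise bound is a Lipschitz bound.\<close>

lemma strict_derivative_at_singleton:
  assumes u: "u \<in> U" "B u = {A}" and "0 < \<epsilon>"
  shows "\<exists>\<delta>>0. \<forall>v\<in>ball u \<delta>. \<forall>w\<in>ball u \<delta>. norm (f w - f v - A (w - v)) \<le> \<epsilon> * norm (w - v)"
proof -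
  obtain \<delta>1 where \<delta>1: "\<delta>1 > 0" "\<And>v A'. v \<in> U \<Longrightarrow> norm (v - u) < \<delta>1 \<Longrightarrow> A' \<in> B v \<Longrightarrow> norm (A' - A) < \<epsilon> / 2"
    using upper_semicontinuous_at_singleton[OF u, of "\<epsilon> / 2"] \<open>0 < \<epsilon>\<close> by fastforce
  obtain \<delta>2 where \<delta>2: "\<delta>2 > 0" "ball u \<delta>2 \<subseteq> U"
    using open_U u(1) openE by blast
  define \<delta> where "\<delta> = min \<delta>1 \<delta>2"
  have near: "v \<in> U" "A' \<in> B v \<Longrightarrow> norm (A' - A) < \<epsilon> / 2" if "v \<in> ball u \<delta>" for v A'
    using that \<delta>2(2) \<delta>1(2)[of v A'] by (auto simp: \<delta>_def dist_norm norm_minus_commute)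
  have "norm ((f w - A w) - (f v - A v)) \<le> \<epsilon> * norm (w - v)" if vw: "v \<in> ball u \<delta>" "w \<in> ball u \<delta>" for v w
  proof (rule pointwise_lipschitz_imp_norm_diff_le[OF convex_ball vw])
    fix z assume z: "z \<in> ball u \<delta>"
    obtain d where d: "d > 0"
      "\<And>y A'. y \<in> U \<Longrightarrow> norm (y - z) < d \<Longrightarrow> A' \<in> B y \<Longrightarrow> norm (f y - f z - A' (y - z)) \<le> \<epsilon> / 2 * norm (y - z)"
      using semismooth[OF near(1)[OF z], of "\<epsilon> / 2"] \<open>0 < \<epsilon>\<close> by auto
    have "norm ((f y - A y) - (f z - A z)) \<le> \<epsilon> * norm (y - z)" if y: "y \<in> ball u \<delta>" "norm (y - z) < d" for y
    proof -
      obtain A' where A': "A' \<in> B y"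
        using nonempty near(1)[OF y(1)] by blast
      \<comment> \<open>Half of \<epsilon> pays for the semismoothness error at \<open>z\<close>,
        the other half for exchanging \<open>A'\<close> with \<open>A\<close>.\<close>
      have "(f y - A y) - (f z - A z) = (f y - f z - A' (y - z)) + (A' - A) (y - z)"
        by (simp add: blinfun.diff_left blinfun.diff_right)
      also have "norm \<dots> \<le> \<epsilon> / 2 * norm (y - z) + norm (A' - A) * norm (y - z)"
        using d(2)[OF near(1)[OF y(1)] y(2) A'] norm_blinfun[of "A' - A" "y - z"]
        by (intro norm_triangle_mono)
      also have "\<dots> \<le> \<epsilon> / 2 * norm (y - z) + \<epsilon> / 2 * norm (y - z)"
        using near(2)[OF y(1) A'] by (intro add_left_mono mult_right_mono) auto
      finally show ?thesis by simp
    qed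
    then show "\<exists>d>0. \<forall>y\<in>ball u \<delta>. norm (y - z) < d \<longrightarrow> norm ((f y - A y) - (f z - A z)) \<le> \<epsilon> * norm (y - z)"
      using d(1) by blast
  qed
  then show ?thesis
    using \<delta>1(1) \<delta>2(1) by (intro exI[of _ \<delta>]) (auto simp: \<delta>_def blinfun.diff_right algebra_simps)
qed

section \<open>Multivalued points form a null set\<close>

definition spread :: "'a \<Rightarrow> real \<Rightarrow> 'a set" where
  "spread e r = {u \<in> U. \<exists>A\<in>B u. \<exists>A'\<in>B u. r \<le> norm (A e - A' e)}"

text \<open>The weak inequality in \<open>spread\<close> survives limits, so by compactness and the
  closed graph the set is relatively closed in the open set \<open>U\<close>.\<close>

lemma spread_borel: "spread e r \<in> sets borel"
proof -
  have "U \<inter> closure (spread e r) \<subseteq> spread e r"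
  proof
    fix u assume "u \<in> U \<inter> closure (spread e r)"
    then obtain v where u: "u \<in> U" and v: "\<And>k. v k \<in> spread e r" "v \<longlonglongrightarrow> u"
      by (auto simp: closure_sequential)
    from v(1) have vU: "\<And>k. v k \<in> U"
      by (simp add: spread_def)
    from v(1) obtain G G' where G: "\<And>k. G k \<in> B (v k)" "\<And>k. G' k \<in> B (v k)" "\<And>k. r \<le> norm (G k e - G' k e)"
      unfolding spread_def by simp metis
    obtain A \<rho> where A: "A \<in> B u" "strict_mono (\<rho> :: nat \<Rightarrow> nat)" "(G \<circ> \<rho>) \<longlonglongrightarrow> A"
      using convergent_subsequence[of v u G] vU v(2) u G(1) by blast
    have "(v \<circ> \<rho>) \<longlonglongrightarrow> u"
      using A(2) v(2) LIMSEQ_subseq_LIMSEQ by blast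
    \<comment> \<open>The second subsequence is extracted from the first, so that both operator
      sequences converge along the same indices.\<close>
    then obtain A' \<rho>' where A': "A' \<in> B u" "strict_mono (\<rho>' :: nat \<Rightarrow> nat)" "(G' \<circ> \<rho> \<circ> \<rho>') \<longlonglongrightarrow> A'"
      using convergent_subsequence[of "v \<circ> \<rho>" u "G' \<circ> \<rho>"] vU u G(2) by (metis comp_apply)
    have "(G \<circ> \<rho> \<circ> \<rho>') \<longlonglongrightarrow> A"
      using A(3) A'(2) LIMSEQ_subseq_LIMSEQ by blast
    with A'(3) have "(\<lambda>k. norm ((G \<circ> \<rho> \<circ> \<rho>') k e - (G' \<circ> \<rho> \<circ> \<rho>') k e)) \<longlonglongrightarrow> norm (A e - A' e)"
      by (intro tendsto_intros)
    then have "r \<le> norm (A e - A' e)"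
      by (rule LIMSEQ_le_const) (use G(3) in auto)
    then show "u \<in> spread e r"
      using A(1) A'(1) u by (auto simp: spread_def)
  qed
  moreover have "spread e r \<subseteq> U"
    by (auto simp: spread_def)
  ultimately have "spread e r = U \<inter> closure (spread e r)"
    using closure_subset[of "spread e r"] by blast
  then show ?thesis
    using open_U by (metis borel_closed borel_open closed_closure sets.Int)
qed

text \<open>For two points of the line, \<open>v - u\<close> is a multiple of \<open>e\<close>, and
  all elements of \<open>B v\<close> reproduce \<open>f v - f u\<close> on it up to a small multiple
  of \<open>norm (v - u)\<close>. Hence they agree on \<open>e\<close> up to less than
  \<open>r\<close> once \<open>v \<noteq> u\<close> is close to \<open>u\<close>. The parameters in
  question thus have no limit point in the open set \<open>D\<close>, and such a set is
  countable.\<close>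

lemma spread_countable_on_lines:
  assumes "0 < r"
  shows "countable {t. x + t *\<^sub>R e \<in> spread e r}"
\<comment> \<open>For \<open>e = 0\<close> all values \<open>A e\<close> vanish, so the set is empty
  because \<open>r\<close> is positive.\<close>
proof (cases "e = 0")
  case True
  then show ?thesis
    using assms by (simp add: spread_def)
next
  case False
  define D where "D = {t. x + t *\<^sub>R e \<in> U}"
  have "open D"
    using open_vimage[OF open_U, of "\<lambda>t. x + t *\<^sub>R e"]
    by (simp add: D_def vimage_def continuous_intros)
  have "\<not> t islimpt {t. x + t *\<^sub>R e \<in> spread e r}" if "t \<in> D" for t
  proof -
    let ?u = "x + t *\<^sub>R e"
    have u: "?u \<in> U"
      using that by (simp add: D_def)
    \<comment> \<open>Two errors of size \<epsilon> times \<open>norm (v - u)\<close> add up to only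
      two thirds of \<open>\<bar>s - t\<bar> * r\<close>, which gives the contradiction.\<close>
    define \<epsilon> where "\<epsilon> = r / (3 * norm e)"
    have "0 < \<epsilon>"
      using False assms by (simp add: \<epsilon>_def)
    then obtain \<delta> where \<delta>: "\<delta> > 0"
      "\<And>v A. v \<in> U \<Longrightarrow> norm (v - ?u) < \<delta> \<Longrightarrow> A \<in> B v \<Longrightarrow> norm (f v - f ?u - A (v - ?u)) \<le> \<epsilon> * norm (v - ?u)"
      using semismooth[OF u] by meson
    have "s = t" if s: "x + s *\<^sub>R e \<in> spread e r" "dist s t < \<delta> / norm e" for s
    proof (rule ccontr)
      let ?v = "x + s *\<^sub>R e"
      assume "s \<noteq> t"
      have v: "?v - ?u = (s - t) *\<^sub>R e"
        by (simp add: algebra_simps)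
      have v_near: "norm (?v - ?u) < \<delta>"
        using s(2) False unfolding v by (simp add: dist_real_def pos_less_divide_eq)
      obtain A A' where A: "?v \<in> U" "A \<in> B ?v" "A' \<in> B ?v" "r \<le> norm (A e - A' e)"
        using s(1) by (auto simp: spread_def)
      have "\<bar>s - t\<bar> * r \<le> \<bar>s - t\<bar> * norm (A e - A' e)"
        using A(4) by (intro mult_left_mono) auto
      also have "\<dots> = norm (A (?v - ?u) - A' (?v - ?u))"
        unfolding v by (simp add: blinfun.scaleR_right flip: scaleR_diff_right)
      also have "\<dots> \<le> norm (f ?v - f ?u - A (?v - ?u)) + norm (f ?v - f ?u - A' (?v - ?u))"
        by norm
      also have "\<dots> \<le> \<epsilon> * norm (?v - ?u) + \<epsilon> * norm (?v - ?u)"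
        using A v_near by (intro add_mono \<delta>(2)) auto
      also have "\<dots> = 2 / 3 * (\<bar>s - t\<bar> * r)"
        using False unfolding v by (simp add: \<epsilon>_def)
      finally show False
        using \<open>s \<noteq> t\<close> assms by (simp add: mult_le_0_iff)
    qed
    moreover have "0 < \<delta> / norm e"
      using \<delta>(1) False by simp
    ultimately show ?thesis
      unfolding islimpt_approachable by blast
  qed
  then have "{t. x + t *\<^sub>R e \<in> spread e r} sparse_in D"
    using \<open>open D\<close> by (simp add: sparse_in_open)
  then have "countable (D \<inter> {t. x + t *\<^sub>R e \<in> spread e r})"
    using \<open>open D\<close> sparse_imp_countable by blast
  moreover have "{t. x + t *\<^sub>R e \<in> spread e r} \<subseteq> D"
    by (auto simp: D_def spread_def)
  ultimately show ?thesis
    by (simp add: Int_absorb1)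
qed

text \<open>Two distinct linear maps differ on some basis vector, and there by at least some
  1/(k+1). This leaves countably many sets, each null because it meets the lines in one direction in
  countable sets.\<close>

theorem negligible_not_singleton: "negligible {u \<in> U. \<not> is_singleton (B u)}"
proof (rule negligible_subset)
  show "negligible (\<Union>e\<in>Basis. \<Union>k. spread e (inverse (real (Suc k))))"
  proof (intro negligible_Union finite_imageI finite_Basis, safe)
    fix e :: 'a
    show "negligible (\<Union>k. spread e (inverse (real (Suc k))))"
      by (intro negligible_countable_Union)
        (auto intro!: negligible_if_countable_on_lines[OF spread_borel] spread_countable_on_lines)
  qed
  show "{u \<in> U. \<not> is_singleton (B u)} \<subseteq> (\<Union>e\<in>Basis. \<Union>k. spread e (inverse (real (Suc k))))"
  proof
    fix u assume u: "u \<in> {u \<in> U. \<not> is_singleton (B u)}"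
    then obtain A A' where A: "A \<in> B u" "A' \<in> B u" "A \<noteq> A'"
      using nonempty by (metis (no_types, lifting) is_singletonI' mem_Collect_eq)
    then obtain e where e: "e \<in> Basis" "A e \<noteq> A' e"
      using blinfun_euclidean_eqI by metis
    then obtain k where "inverse (real (Suc k)) < norm (A e - A' e)"
      using reals_Archimedean[of "norm (A e - A' e)"] by auto
    then have "u \<in> spread e (inverse (real (Suc k)))"
      using A u unfolding spread_def by (auto intro: less_imp_le)
    then show "u \<in> (\<Union>e\<in>Basis. \<Union>k. spread e (inverse (real (Suc k))))"
      using e by blast
  qed
qed

end


section \<open>Hausdorff null sets\<close>

text \<open>Outer regularity of Lebesgue measure: removing the null set \<open>S\<close> from
  \<open>T\<close> does not change the measure.\<close>

lemma negligible_open_superset: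
  fixes S :: "'a::euclidean_space set"
  assumes "negligible S" "0 < e"
  obtains T where "open T" "S \<subseteq> T" "T \<in> lmeasurable" "measure lebesgue T < e"
proof -
  obtain T where T: "open T" "S \<subseteq> T" "T - S \<in> lmeasurable" "emeasure lebesgue (T - S) < ennreal e"
    using sets_lebesgue_outer_open[of S e] assms negligible_imp_sets by blast
  have "emeasure lebesgue T = emeasure lebesgue (T - S)"
    using T(1) assms(1) by (subst emeasure_Diff_null_set) (auto simp: negligible_iff_null_sets)
  then have less: "emeasure lebesgue T < ennreal e"
    using T(4) by simp
  then have "T \<in> lmeasurable"
    using T(1) by (intro fmeasurableI) (auto simp: order.strict_trans[OF _ ennreal_less_top])
  moreover have "measure lebesgue T < e"
    using less assms(2) by (simp add: emeasure_eq_measure2[OF calculation] ennreal_less_iff)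
  ultimately show thesis
    using that T by blast
qed

text \<open>Allows covers indexed by any countable family and reduces the infinite series to its
  finite partial sums, the form in which volumes of disjoint cubes are compared.\<close>

lemma hausdorff_premeasure_le:
  assumes "countable \<D>" "A \<subseteq> (\<Union>D\<in>\<D>. E D)" "0 \<le> c"
    and E: "\<And>D. D \<in> \<D> \<Longrightarrow> bounded (E D)" "\<And>D. D \<in> \<D> \<Longrightarrow> diameter (E D) \<le> \<delta>" and "0 \<le> \<delta>"
    and c: "\<And>\<F>. finite \<F> \<Longrightarrow> \<F> \<subseteq> \<D> \<Longrightarrow>
      (\<Sum>D\<in>\<F>. unit_ball_vol (real d) * (diameter (E D) / 2) ^ d) \<le> c"
  shows "hausdorff_premeasure d \<delta> A \<le> ennreal c"
proof -
  define I where "I = to_nat_on \<D> ` \<D>"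
  \<comment> \<open>Indices outside \<open>I\<close> receive the empty set, which contributes 0 to
    the premeasure.\<close>
  define E' where "E' i = (if i \<in> I then E (from_nat_into \<D> i) else {})" for i
  have inv: "from_nat_into \<D> i \<in> \<D>" if "i \<in> I" for i
    using that \<open>countable \<D>\<close> by (auto simp: I_def)
  have inj: "inj_on (from_nat_into \<D>) I"
    using \<open>countable \<D>\<close> by (auto simp: I_def inj_on_def)
  have "A \<subseteq> (\<Union>i. E' i)"
  proof
    fix x assume "x \<in> A"
    then obtain D where "D \<in> \<D>" "x \<in> E D"
      using assms(2) by blast
    then have "x \<in> E' (to_nat_on \<D> D)"
      using \<open>countable \<D>\<close> by (auto simp: E'_def I_def)
    then show "x \<in> (\<Union>i. E' i)" by blast
  qed
  moreover have "bounded (E' i)" "diameter (E' i) \<le> \<delta>" for i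
    using E inv \<open>0 \<le> \<delta>\<close> by (auto simp: E'_def)
  ultimately have "hausdorff_premeasure d \<delta> A \<le> (\<Sum>i. if E' i = {} then 0
      else ennreal (unit_ball_vol (real d) * (diameter (E' i) / 2) ^ d))"
    unfolding hausdorff_premeasure_def by (intro INF_lower) auto
  also have "\<dots> \<le> ennreal c"
  proof (rule suminf_le_const)
    fix n
    let ?t = "\<lambda>D. unit_ball_vol (real d) * (diameter (E D) / 2) ^ d"
    have t_nonneg: "0 \<le> ?t D" if "D \<in> \<D>" for D
      using diameter_ge_0[OF E(1)[OF that]] by simp
    have "(\<Sum>i<n. if E' i = {} then 0 else ennreal (unit_ball_vol (real d) * (diameter (E' i) / 2) ^ d))
        = (\<Sum>i\<in>{..<n} \<inter> I. if E' i = {} then 0 else ennreal (unit_ball_vol (real d) * (diameter (E' i) / 2) ^ d))"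
      by (intro sum.mono_neutral_right) (auto simp: E'_def)
    \<comment> \<open>Only an inequality, since \<open>E D\<close> itself may be empty and then
      counts as 0 on the left.\<close>
    also have "\<dots> \<le> (\<Sum>i\<in>{..<n} \<inter> I. ennreal (?t (from_nat_into \<D> i)))"
      by (intro sum_mono) (auto simp: E'_def)
    also have "\<dots> = ennreal (\<Sum>i\<in>{..<n} \<inter> I. ?t (from_nat_into \<D> i))"
      by (intro sum_ennreal t_nonneg inv) auto
    also have "(\<Sum>i\<in>{..<n} \<inter> I. ?t (from_nat_into \<D> i)) = (\<Sum>D\<in>from_nat_into \<D> ` ({..<n} \<inter> I). ?t D)"
      using inj_on_subset[OF inj] by (subst sum.reindex) auto
    also have "ennreal \<dots> \<le> ennreal c"
      using inv by (intro ennreal_leI c) auto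
    finally show "(\<Sum>i<n. if E' i = {} then 0 else ennreal (unit_ball_vol (real d) * (diameter (E' i) / 2) ^ d)) \<le> ennreal c" .
  qed auto
  finally show ?thesis .
qed

text \<open>Cover \<open>S\<close> by small non-overlapping cubes inside an open set
  \<open>T\<close> of small measure. The image of a cube of side \<open>s\<close> has diameter at
  most a constant times \<open>s\<close>, so its term is at most a constant times the volume of the
  cube, and the volumes add up to at most that of \<open>T\<close>.\<close>

lemma hausdorff_measure_lipschitz_image_negligible:
  fixes S :: "'a::euclidean_space set" and g :: "'a \<Rightarrow> 'c::metric_space"
  assumes S: "negligible S" "bounded S" and g: "L-lipschitz_on S g"
  shows "hausdorff_measure DIM('a) (g ` S) = 0"
proof -
  \<comment> \<open>A strictly positive Lipschitz constant, as it is divided by below.\<close>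
  define K where "K = L + 1"
  have "K > 0"
    using lipschitz_on_nonneg[OF g] by (simp add: K_def)
  have K: "dist (g x) (g y) \<le> K * dist x y" if "x \<in> S" "y \<in> S" for x y
    using lipschitz_onD[OF g that] by (simp add: K_def algebra_simps add_increasing)
  \<comment> \<open>A cube of side \<open>s\<close> has diameter at most \<open>DIM('a) * s\<close>
    by the l1 bound, so its image contributes at most \<kappa> times its volume; the factor 1/2 in
    the premeasure is simply given away.\<close>
  define \<kappa> where "\<kappa> = unit_ball_vol (real DIM('a)) * (K * DIM('a)) ^ DIM('a)"
  have "\<kappa> > 0"
    using \<open>K > 0\<close> by (simp add: \<kappa>_def)
  have "hausdorff_premeasure DIM('a) \<delta> (g ` S) \<le> ennreal e" if "\<delta> > 0" "e > 0" for \<delta> e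
  proof -
    obtain T where T: "open T" "S \<subseteq> T" "T \<in> lmeasurable" "measure lebesgue T < e / \<kappa>"
      using negligible_open_superset[OF S(1), of "e / \<kappa>"] \<open>\<kappa> > 0\<close> \<open>e > 0\<close> by auto
    \<comment> \<open>A cube within \<open>ball x r\<close> then lies in \<open>T\<close>, and its
      image has diameter at most \<open>K * (2 * r) \<le> \<delta>\<close>.\<close>
    have "\<exists>r>0. r \<le> \<delta> / (2 * K) \<and> (x \<in> S \<longrightarrow> ball x r \<subseteq> T)" for x
    proof (cases "x \<in> S")
      case True
      then obtain r where "r > 0" "ball x r \<subseteq> T"
        using T(1,2) by (meson openE subsetD)
      then show ?thesis
        using \<open>K > 0\<close> \<open>\<delta> > 0\<close> by (intro exI[of _ "min r (\<delta> / (2 * K))"]) auto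
    qed (use \<open>K > 0\<close> \<open>\<delta> > 0\<close> in \<open>auto intro!: exI[of _ "\<delta> / (2 * K)"]\<close>)
    then obtain R where R: "\<And>x. R x > 0" "\<And>x. R x \<le> \<delta> / (2 * K)" "\<And>x. x \<in> S \<Longrightarrow> ball x (R x) \<subseteq> T"
      by metis
    \<comment> \<open>The dyadic subdivision starts from one large cube; boundedness of
      \<open>S\<close> supplies it.\<close>
    obtain c where c: "S \<subseteq> cbox (- c *\<^sub>R One) (c *\<^sub>R One)" "box (- c *\<^sub>R One :: 'a) (c *\<^sub>R One) \<noteq> {}"
    proof -
      obtain b where b: "b > 0" "\<And>x. x \<in> S \<Longrightarrow> norm x \<le> b"
        using S(2) bounded_pos by metis
      have "\<bar>x \<bullet> i\<bar> \<le> b" if "x \<in> S" "i \<in> Basis" for x i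
        using b(2)[OF that(1)] Basis_le_norm[OF that(2), of x] by linarith
      then have "S \<subseteq> cbox (- b *\<^sub>R One) (b *\<^sub>R One)"
        by (fastforce simp: mem_box abs_le_iff)
      then show thesis
        using that b(1) by (simp add: box_eq_empty)
    qed
    have "gauge (\<lambda>x. ball x (R x))"
      using R(1) by (simp add: gauge_def)
    then obtain \<D> where \<D>: "countable \<D>"
      and cbox: "\<And>D. D \<in> \<D> \<Longrightarrow> interior D \<noteq> {} \<and> (\<exists>c d. D = cbox c d)"
      and disj: "pairwise (\<lambda>A B. interior A \<inter> interior B = {}) \<D>"
      and sub: "\<And>D. D \<in> \<D> \<Longrightarrow> \<exists>x \<in> S \<inter> D. D \<subseteq> (\<lambda>x. ball x (R x)) x"
      and side: "\<And>u v. cbox u v \<in> \<D> \<Longrightarrow> \<exists>n. \<forall>i\<in>Basis. v \<bullet> i - u \<bullet> i = (2 * c) / 2 ^ n"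
      and cover: "S \<subseteq> \<Union>\<D>"
      using covering_lemma[OF c, of "\<lambda>x. ball x (R x)"] by force
    have image: "bounded (g ` (S \<inter> D))" "diameter (g ` (S \<inter> D)) \<le> K * s"
      if "0 \<le> s" "\<And>x y. x \<in> D \<Longrightarrow> y \<in> D \<Longrightarrow> dist x y \<le> s" for D s
    proof -
      have *: "dist (g x) (g y) \<le> K * s" if xy: "x \<in> S \<inter> D" "y \<in> S \<inter> D" for x y
      proof -
        have "dist x y \<le> s"
          using xy by (intro \<open>\<And>x y. x \<in> D \<Longrightarrow> y \<in> D \<Longrightarrow> dist x y \<le> s\<close>) auto
        then have "K * dist x y \<le> K * s"
          using \<open>K > 0\<close> by simp
        then show ?thesis
          using K[of x y] xy by auto
      qed
      then show "bounded (g ` (S \<inter> D))"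
        unfolding bounded_two_points by blast
      show "diameter (g ` (S \<inter> D)) \<le> K * s"
        unfolding diameter_def using * \<open>0 \<le> s\<close> \<open>K > 0\<close> by (auto intro!: cSUP_least)
    qed
    show ?thesis
    proof (rule hausdorff_premeasure_le[where E = "\<lambda>D. g ` (S \<inter> D)" and \<D> = \<D>])
      show "g ` S \<subseteq> (\<Union>D\<in>\<D>. g ` (S \<inter> D))"
        using cover by blast
    next
      fix D assume "D \<in> \<D>"
      then obtain x where x: "x \<in> S \<inter> D" "D \<subseteq> ball x (R x)"
        using sub by blast
      have "dist y z \<le> 2 * R x" if "y \<in> D" "z \<in> D" for y z
      proof -
        have "dist x y < R x" "dist x z < R x"
          using that x(2) by auto
        then show ?thesis
          using dist_triangle[of y z x] by (simp add: dist_commute)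
      qed
      note * = image[of "2 * R x" D, OF _ this]
      show "bounded (g ` (S \<inter> D))"
        using *(1) R(1)[of x] by (simp add: less_imp_le)
      have "K * (2 * R x) \<le> \<delta>"
        using R(2)[of x] \<open>K > 0\<close> by (simp add: field_simps)
      then show "diameter (g ` (S \<inter> D)) \<le> \<delta>"
        using *(2) R(1)[of x] by (simp add: less_imp_le)
    next
      fix \<F> assume \<F>: "finite \<F>" "\<F> \<subseteq> \<D>"
      have "(\<Sum>D\<in>\<F>. unit_ball_vol (real DIM('a)) * (diameter (g ` (S \<inter> D)) / 2) ^ DIM('a))
          \<le> (\<Sum>D\<in>\<F>. \<kappa> * measure lebesgue D)"
      proof (rule sum_mono)
        fix D assume "D \<in> \<F>"
        then have "D \<in> \<D>" using \<F> by blast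
        then obtain u v where uv: "D = cbox u v" "box u v \<noteq> {}"
          using cbox[OF \<open>D \<in> \<D>\<close>] by (metis interior_cbox)
        then obtain n where n: "\<And>i. i \<in> Basis \<Longrightarrow> v \<bullet> i - u \<bullet> i = 2 * c / 2 ^ n"
          using side[of u v] \<open>D \<in> \<D>\<close> by auto
        define s where "s = 2 * c / 2 ^ n"
        have "s \<ge> 0"
          using uv(2) n SOME_Basis unfolding s_def by (force simp: box_ne_empty)
        have "dist x y \<le> DIM('a) * s" if "x \<in> D" "y \<in> D" for x y
        proof -
          have "dist x y \<le> (\<Sum>i\<in>Basis. \<bar>(x - y) \<bullet> i\<bar>)"
            unfolding dist_norm by (rule norm_le_l1)
          also have "\<dots> \<le> (\<Sum>i\<in>(Basis :: 'a set). s)"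
          proof (rule sum_mono)
            fix i :: 'a assume i: "i \<in> Basis"
            then show "\<bar>(x - y) \<bullet> i\<bar> \<le> s"
              using that n[OF i] unfolding uv(1) s_def[symmetric]
              by (auto simp: mem_box inner_diff_left abs_le_iff dest!: bspec[OF _ i])
          qed
          finally show ?thesis by simp
        qed
        then have diam: "bounded (g ` (S \<inter> D))" "diameter (g ` (S \<inter> D)) \<le> K * (DIM('a) * s)"
          using image[of "DIM('a) * s" D] \<open>s \<ge> 0\<close> by auto
        have "(\<Prod>i\<in>Basis. (v - u) \<bullet> i) = (\<Prod>i\<in>(Basis :: 'a set). s)"
          using n by (intro prod.cong) (auto simp: inner_diff_left s_def)
        then have "measure lebesgue D = s ^ DIM('a)"
          using uv by (simp add: box_ne_empty less_imp_le)
        moreover have "(diameter (g ` (S \<inter> D)) / 2) ^ DIM('a) \<le> (K * (DIM('a) * s)) ^ DIM('a)"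
          using diam diameter_ge_0[OF diam(1)] by (intro power_mono) auto
        ultimately show "unit_ball_vol (real DIM('a)) * (diameter (g ` (S \<inter> D)) / 2) ^ DIM('a) \<le> \<kappa> * measure lebesgue D"
          by (simp add: \<kappa>_def power_mult_distrib mult.assoc mult_left_mono)
      qed
      also have "\<dots> = \<kappa> * measure lebesgue (\<Union>\<F>)"
      proof -
        have "D \<in> lmeasurable" if "D \<in> \<F>" for D
          using cbox[of D] that \<F>(2) by auto
        \<comment> \<open>Distinct cubes may share faces, but these are convex sets with empty
          interior and hence null.\<close>
        moreover have "pairwise (\<lambda>A B. negligible (A \<inter> B)) \<F>"
        proof (rule pairwiseI)
          fix A B assume *: "A \<in> \<F>" "B \<in> \<F>" "A \<noteq> B"
          then have "convex (A \<inter> B)"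
            using cbox \<F>(2) by (metis convex_Int convex_box(1) subsetD)
          moreover have "interior (A \<inter> B) = {}"
            using * disj \<F>(2) by (auto simp: pairwise_def)
          ultimately show "negligible (A \<inter> B)"
            by (simp add: negligible_convex_interior)
        qed
        ultimately show ?thesis
          using \<F>(1) by (simp add: measure_negligible_finite_Union sum_distrib_left)
      qed
      also have "\<dots> \<le> \<kappa> * measure lebesgue T"
      proof (intro mult_left_mono measure_mono_fmeasurable T(3))
        show "\<Union>\<F> \<subseteq> T"
          using sub R(3) \<F>(2) by blast
        show "\<Union>\<F> \<in> sets lebesgue"
          using \<F> cbox by (intro sets.finite_Union) (auto, metis lmeasurable_cbox fmeasurableD subsetD)
      qed (use \<open>\<kappa> > 0\<close> in auto)
      also have "\<dots> \<le> e"
        using T(4) \<open>\<kappa> > 0\<close> by (simp add: field_simps)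
      finally show "(\<Sum>D\<in>\<F>. unit_ball_vol (real DIM('a)) * (diameter (g ` (S \<inter> D)) / 2) ^ DIM('a)) \<le> e" .
    qed (use \<D> that in auto)
  qed
  then have "hausdorff_premeasure DIM('a) \<delta> (g ` S) = 0" if "\<delta> > 0" for \<delta>
    using that ennreal_le_epsilon[of 0 "hausdorff_premeasure DIM('a) \<delta> (g ` S)"] by simp
  then show ?thesis
    by (simp add: hausdorff_measure_def)
qed


section \<open>The metric on subspaces\<close>

text \<open>The difference of two candidates lies in both \<open>L\<close> and its orthogonal
  complement and is therefore 0, so the definite description is well defined.\<close>

lemma orth_projection_eqI:
  assumes "subspace L" "p \<in> L" "z - p \<in> L\<^sup>\<bottom>"
  shows "orth_projection L z = p"
  unfolding orth_projection_def
proof (rule the_equality)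
  fix q assume q: "q \<in> L \<and> z - q \<in> L\<^sup>\<bottom>"
  then have "p - q \<in> L"
    using assms by (simp add: subspace_diff)
  moreover have "p - q \<in> L\<^sup>\<bottom>"
    using subspace_diff[OF subspace_orthogonal_comp, of "z - q" L "z - p"] q assms(3) by simp
  ultimately have "orthogonal (p - q) (p - q)"
    by (auto simp: orthogonal_comp_def)
  then show "q = p"
    by (simp add: orthogonal_self)
qed (use assms in auto)

lemma
  fixes L :: "'c::euclidean_space set"
  assumes "subspace L"
  shows orth_projection_mem: "orth_projection L z \<in> L"
    and diff_orth_projection_mem: "z - orth_projection L z \<in> L\<^sup>\<bottom>"
proof -
  obtain p q where pq: "p \<in> span L" "\<And>w. w \<in> span L \<Longrightarrow> orthogonal q w" "z = p + q"
    using orthogonal_subspace_decomp_exists[of L z] by blast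
  moreover have "span L = L"
    using assms by (simp add: span_eq_iff)
  ultimately have "p \<in> L" "z - p \<in> L\<^sup>\<bottom>"
    by (auto simp: orthogonal_comp_def orthogonal_commute)
  then show "orth_projection L z \<in> L" "z - orth_projection L z \<in> L\<^sup>\<bottom>"
    using orth_projection_eqI[OF assms] by simp_all
qed

lemma bounded_linear_orth_projection:
  fixes L :: "'c::euclidean_space set"
  assumes "subspace L"
  shows "bounded_linear (orth_projection L)"
proof -
  note P = orth_projection_mem[OF assms] diff_orth_projection_mem[OF assms]
  have "linear (orth_projection L)"
  proof (rule linearI)
    fix x y :: 'c and c :: real
    have "(x - orth_projection L x) + (y - orth_projection L y) \<in> L\<^sup>\<bottom>"
      by (intro subspace_add subspace_orthogonal_comp P)
    then show "orth_projection L (x + y) = orth_projection L x + orth_projection L y"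
      by (intro orth_projection_eqI assms subspace_add P) (simp add: algebra_simps)
    have "c *\<^sub>R (x - orth_projection L x) \<in> L\<^sup>\<bottom>"
      by (intro subspace_scale subspace_orthogonal_comp P)
    then show "orth_projection L (c *\<^sub>R x) = c *\<^sub>R orth_projection L x"
      by (intro orth_projection_eqI assms subspace_scale P) (simp add: algebra_simps)
  qed
  then show ?thesis
    by (simp add: linear_conv_bounded_linear)
qed

lemma orth_projection_inner:
  assumes "subspace L" "l \<in> L"
  shows "l \<bullet> (z - orth_projection L z) = 0"
  using diff_orth_projection_mem[OF assms(1), of z] assms(2)
  by (simp add: orthogonal_comp_def orthogonal_def)

lemma norm_diff_orth_projection_le:
  fixes L :: "'c::euclidean_space set"
  assumes "subspace L" "l \<in> L"
  shows "norm (z - orth_projection L z) \<le> norm (z - l)"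
proof -
  let ?p = "orth_projection L z"
  have "?p - l \<in> L"
    using assms by (simp add: subspace_diff orth_projection_mem)
  then have "orthogonal (z - ?p) (?p - l)"
    using orth_projection_inner[OF assms(1)] by (simp add: orthogonal_def inner_commute[of "z - ?p"])
  then have "(norm (z - ?p + (?p - l)))\<^sup>2 = (norm (z - ?p))\<^sup>2 + (norm (?p - l))\<^sup>2"
    by (rule norm_add_Pythagorean)
  then have "(norm (z - ?p))\<^sup>2 \<le> (norm (z - l))\<^sup>2"
    by simp
  then show ?thesis
    by (rule power2_le_imp_le) simp
qed

lemma norm_orth_projection_le:
  fixes L :: "'c::euclidean_space set"
  assumes "subspace L"
  shows "norm (orth_projection L z) \<le> norm z"
proof -
  let ?p = "orth_projection L z"
  have "orthogonal ?p (z - ?p)"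
    using orth_projection_inner[OF assms orth_projection_mem[OF assms]] by (simp add: orthogonal_def)
  then have "(norm (?p + (z - ?p)))\<^sup>2 = (norm ?p)\<^sup>2 + (norm (z - ?p))\<^sup>2"
    by (rule norm_add_Pythagorean)
  then have "(norm ?p)\<^sup>2 \<le> (norm z)\<^sup>2"
    by simp
  then show ?thesis
    by (rule power2_le_imp_le) simp
qed

lemma norm_orth_projection_diff_le_subspace_dist:
  fixes L1 L2 :: "'c::euclidean_space set"
  assumes "subspace L1" "subspace L2"
  shows "norm (orth_projection L1 z - orth_projection L2 z) \<le> subspace_dist L1 L2 * norm z"
  unfolding subspace_dist_def
  by (rule onorm[OF bounded_linear_sub[OF assms[THEN bounded_linear_orth_projection]]])

lemma subspace_dist_nonneg: "subspace L1 \<Longrightarrow> subspace L2 \<Longrightarrow> 0 \<le> subspace_dist L1 L2"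
  unfolding subspace_dist_def
  by (rule onorm_pos_le[OF bounded_linear_sub[OF bounded_linear_orth_projection bounded_linear_orth_projection]])

lemma subspace_dist_triangle:
  fixes L1 L2 L3 :: "'c::euclidean_space set"
  assumes "subspace L1" "subspace L2" "subspace L3"
  shows "subspace_dist L1 L3 \<le> subspace_dist L1 L2 + subspace_dist L2 L3"
  unfolding subspace_dist_def[of L1 L3]
proof (rule onorm_le)
  fix z
  have "norm (orth_projection L1 z - orth_projection L3 z)
      \<le> norm (orth_projection L1 z - orth_projection L2 z) + norm (orth_projection L2 z - orth_projection L3 z)"
    by norm
  also have "\<dots> \<le> subspace_dist L1 L2 * norm z + subspace_dist L2 L3 * norm z"
    using assms by (intro add_mono norm_orth_projection_diff_le_subspace_dist)
  finally show "norm (orth_projection L1 z - orth_projection L3 z)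
      \<le> (subspace_dist L1 L2 + subspace_dist L2 L3) * norm z"
    by (simp add: algebra_simps)
qed

text \<open>Turns a two-sided gap estimate into a bound for the projection metric. With
  \<open>p\<close> the projection of \<open>z\<close> to \<open>L1\<close>, the difference of the
  two projections of \<open>z\<close> is the error of \<open>p\<close> in \<open>L2\<close> minus
  the projection \<open>q\<close> of \<open>z - p\<close> to \<open>L2\<close>; each direction of
  the gap controls one of these terms.\<close>

lemma subspace_dist_le_gap:
  fixes L1 L2 :: "'c::euclidean_space set"
  assumes L: "subspace L1" "subspace L2" and "0 \<le> c"
    and gap12: "\<And>l. l \<in> L1 \<Longrightarrow> \<exists>m\<in>L2. norm (l - m) \<le> c * norm l"
    and gap21: "\<And>l. l \<in> L2 \<Longrightarrow> \<exists>m\<in>L1. norm (l - m) \<le> c * norm l"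
  shows "subspace_dist L1 L2 \<le> 2 * c"
  unfolding subspace_dist_def
proof (rule onorm_le)
  fix z
  define p where "p = orth_projection L1 z"
  define q where "q = orth_projection L2 (z - p)"
  have q: "q \<in> L2" and p: "p \<in> L1"
    by (simp_all add: p_def q_def orth_projection_mem L)
  obtain m where m: "m \<in> L2" "norm (p - m) \<le> c * norm p"
    using gap12[OF p] by blast
  have "norm (p - orth_projection L2 p) \<le> c * norm p"
    using norm_diff_orth_projection_le[OF L(2) m(1), of p] m(2) by linarith
  also have "\<dots> \<le> c * norm z"
    using norm_orth_projection_le[OF L(1)] \<open>0 \<le> c\<close> by (simp add: p_def mult_left_mono)
  finally have 1: "norm (p - orth_projection L2 p) \<le> c * norm z" .
  obtain m' where m': "m' \<in> L1" "norm (q - m') \<le> c * norm q"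
    using gap21[OF q] by blast
  \<comment> \<open>Since \<open>z - p\<close> is orthogonal to \<open>L1\<close>, a nearby
    \<open>m'\<close> in \<open>L1\<close> may be subtracted from \<open>q\<close> in this inner
    product.\<close>
  have "norm q * norm q = q \<bullet> (z - p)"
    using orth_projection_inner[OF L(2) q, of "z - p"] q_def
    by (simp add: inner_diff_right power2_norm_eq_inner flip: power2_eq_square)
  also have "\<dots> = (q - m') \<bullet> (z - p)"
    using orth_projection_inner[OF L(1) m'(1), of z] p_def by (simp add: inner_diff_left)
  also have "\<dots> \<le> norm (q - m') * norm (z - p)"
    by (rule norm_cauchy_schwarz)
  also have "\<dots> \<le> (c * norm q) * norm z"
    using m'(2) norm_diff_orth_projection_le[OF L(1) subspace_0[OF L(1)], of z]
    by (intro mult_mono) (auto simp: p_def \<open>0 \<le> c\<close>)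
  finally have 2: "norm q \<le> c * norm z"
    using \<open>0 \<le> c\<close> by (cases "q = 0") (auto simp: mult.assoc mult.left_commute[of c])
  have "p - orth_projection L2 z = (p - orth_projection L2 p) - q"
    using linear_diff[OF bounded_linear.linear[OF bounded_linear_orth_projection[OF L(2)]], of z p]
    by (simp add: q_def)
  then have "norm (p - orth_projection L2 z) \<le> norm (p - orth_projection L2 p) + norm q"
    by (metis norm_triangle_ineq4)
  then show "norm (orth_projection L1 z - orth_projection L2 z) \<le> 2 * c * norm z"
    using 1 2 by (simp add: p_def)
qed

section \<open>Convergence of ranges of linear maps\<close>

lemma subspace_range_blinfun: "subspace (range (blinfun_apply M))"
  using linear_subspace_image[OF bounded_linear.linear[OF blinfun.bounded_linear_right] subspace_UNIV] .

text \<open>An injective linear map on a finite-dimensional space is bounded below, and a small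
  perturbation keeps half of the bound \<kappa>. Both gaps between the ranges are then at most
  \<open>2 / \<kappa> * norm (Mk k - M)\<close>.\<close>

lemma tendsto_subspace_dist_range:
  fixes M :: "'a::euclidean_space \<Rightarrow>\<^sub>L 'c::euclidean_space"
  assumes M: "Mk \<longlonglongrightarrow> M" and "inj M"
  shows "(\<lambda>k. subspace_dist (range M) (range (Mk k))) \<longlonglongrightarrow> 0"
proof -
  obtain \<kappa> where \<kappa>: "\<kappa> > 0" "\<And>v. \<kappa> * norm v \<le> norm (M v)"
    using linear_inj_bounded_below_pos[OF bounded_linear.linear[OF blinfun.bounded_linear_right] \<open>inj M\<close>] by blast
  have lim: "(\<lambda>k. norm (Mk k - M)) \<longlonglongrightarrow> 0"
    using M by (simp add: LIM_zero tendsto_norm_zero)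
  then have "\<forall>\<^sub>F k in sequentially. norm (Mk k - M) < \<kappa> / 2"
    using \<kappa>(1) by (intro order_tendstoD) auto
  then have "\<forall>\<^sub>F k in sequentially. norm (subspace_dist (range M) (range (Mk k))) \<le> 4 / \<kappa> * norm (Mk k - M)"
  proof eventually_elim
    case (elim k)
    define c where "c = 2 / \<kappa> * norm (Mk k - M)"
    have close: "norm (Mk k v - M v) \<le> norm (Mk k - M) * norm v" for v
      using norm_blinfun[of "Mk k - M" v] by (simp add: blinfun.diff_left)
    have "subspace_dist (range M) (range (Mk k)) \<le> 2 * c"
    proof (rule subspace_dist_le_gap)
      fix l assume "l \<in> range M"
      then obtain v where v: "l = M v" by blast
      have "norm (M v - Mk k v) \<le> norm (Mk k - M) * norm v"
        using close[of v] by (simp add: norm_minus_commute)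
      also have "\<dots> \<le> norm (Mk k - M) * (norm (M v) / \<kappa>)"
        using \<kappa> by (intro mult_left_mono) (auto simp: field_simps)
      also have "\<dots> \<le> c * norm (M v)"
        using \<kappa>(1) by (simp add: c_def field_simps)
      finally show "\<exists>m\<in>range (Mk k). norm (l - m) \<le> c * norm l"
        using v by blast
    next
      fix l assume "l \<in> range (Mk k)"
      then obtain v where v: "l = Mk k v" by blast
      have "norm (M v) - norm (Mk k v) \<le> norm (Mk k - M) * norm v"
        using close[of v] norm_triangle_ineq2[of "M v" "Mk k v"] by (simp add: norm_minus_commute)
      also have "\<dots> \<le> \<kappa> / 2 * norm v"
        using elim by (intro mult_right_mono) auto
      finally have "norm v \<le> 2 / \<kappa> * norm (Mk k v)"
        using \<kappa>(2)[of v] \<kappa>(1) by (simp add: field_simps)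
      then have "norm (Mk k - M) * norm v \<le> norm (Mk k - M) * (2 / \<kappa> * norm (Mk k v))"
        by (intro mult_left_mono) auto
      with close[of v] have "norm (Mk k v - M v) \<le> c * norm (Mk k v)"
        by (simp add: c_def mult_ac)
      then show "\<exists>m\<in>range M. norm (l - m) \<le> c * norm l"
        using v by blast
    qed (use \<kappa>(1) in \<open>auto simp: c_def subspace_range_blinfun\<close>)
    then show ?case
      by (simp add: c_def subspace_dist_nonneg subspace_range_blinfun)
  qed
  moreover have "(\<lambda>k. 4 / \<kappa> * norm (Mk k - M)) \<longlonglongrightarrow> 0"
    using tendsto_mult_right_zero[OF lim, of "4 / \<kappa>"] by simp
  ultimately show ?thesis
    by (rule Lim_null_comparison)
qed

lemma range_blinfun_in_Zspace:
  fixes M :: "'d::euclidean_space \<Rightarrow>\<^sub>L ('a::euclidean_space \<times> 'b::euclidean_space)"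
  assumes "inj M" "DIM('d) = DIM('a)"
  shows "range M \<in> Zspace"
  using assms dim_image_eq[OF bounded_linear.linear[OF blinfun.bounded_linear_right], of M UNIV]
  by (simp add: Zspace_def subspace_range_blinfun)

text \<open>Primal form of the SCD-ss* inequality. Elements of the adjoint subspaces are normals to
  \<open>L\<close> with exchanged components; testing with the component \<open>n\<close> of
  \<open>z' - z\<close> normal to \<open>L\<close> gives \<open>norm n ^ 2\<close> on the left, so
  \<open>z' - z\<close> is close to its projection to \<open>L\<close>.\<close>

lemma SCD_ss_star_at_near_subspace:
  fixes F :: "'a::euclidean_space \<Rightarrow> 'b::euclidean_space set"
  assumes "SCD_ss_star_at F z" "0 < \<epsilon>"
  shows "\<exists>\<delta>>0. \<forall>z'\<in>gph F. norm (z' - z) \<le> \<delta> \<longrightarrow>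
    (\<forall>L\<in>SC_derivative F z'. \<exists>l\<in>L. norm (z' - z - l) \<le> \<epsilon> * norm (z' - z))"
proof -
  obtain \<delta> where \<delta>: "\<delta> > 0" and bound: "\<And>x y ys xs. (x, y) \<in> gph F \<Longrightarrow> norm ((x, y) - z) \<le> \<delta> \<Longrightarrow>
      (ys, xs) \<in> \<Union> (SC_adjoint F (x, y)) \<Longrightarrow>
      \<bar>xs \<bullet> (x - fst z) - ys \<bullet> (y - snd z)\<bar> \<le> \<epsilon> * norm ((x, y) - z) * norm (ys, xs)"
    using assms unfolding SCD_ss_star_at_def by (force simp: split_beta)
  have "\<exists>l\<in>L. norm (z' - z - l) \<le> \<epsilon> * norm (z' - z)"
    if z': "z' \<in> gph F" "norm (z' - z) \<le> \<delta>" and L: "L \<in> SC_derivative F z'" for z' L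
  proof -
    have "subspace L"
      using L by (simp add: SC_derivative_def Zspace_def)
    define l where "l = orth_projection L (z' - z)"
    define n where "n = z' - z - l"
    have "l \<in> L" "n \<in> L\<^sup>\<bottom>"
      using \<open>subspace L\<close> by (auto simp: l_def n_def orth_projection_mem diff_orth_projection_mem)
    \<comment> \<open>The sign in the adjoint cancels the one in the inequality, whose left side
      becomes the absolute value of \<open>n \<bullet> (z' - z)\<close>.\<close>
    have "(- snd n, fst n) \<in> adjoint_subspace L"
      using \<open>n \<in> L\<^sup>\<bottom>\<close> unfolding adjoint_subspace_def by (cases n) auto
    then have "(- snd n, fst n) \<in> \<Union> (SC_adjoint F z')"
      using L by (auto simp: SC_adjoint_def)
    then have "\<bar>fst n \<bullet> fst (z' - z) + snd n \<bullet> snd (z' - z)\<bar> \<le> \<epsilon> * norm (z' - z) * norm (- snd n, fst n)"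
      using bound[of "fst z'" "snd z'" "- snd n" "fst n"] z' by simp
    moreover have "norm (- snd n, fst n) = norm n"
      by (simp add: norm_prod_def add.commute)
    ultimately have "n \<bullet> (z' - z) \<le> \<epsilon> * norm (z' - z) * norm n"
      by (simp add: inner_prod_def)
    moreover have "n \<bullet> (z' - z) = norm n * norm n"
      using orth_projection_inner[OF \<open>subspace L\<close> \<open>l \<in> L\<close>, of "z' - z"]
      by (simp add: n_def[symmetric] l_def[symmetric] norm_eq_sqrt_inner inner_commute)
        (simp add: n_def inner_diff_left inner_diff_right inner_commute)
    ultimately have "norm n \<le> \<epsilon> * norm (z' - z)"
      using assms(2) by (cases "n = 0") auto
    then show ?thesis
      using \<open>l \<in> L\<close> n_def by blast
  qed
  then show ?thesis
    using \<delta> by blast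
qed


section \<open>Strict differentiability\<close>

text \<open>Both points vary, as the base point does in strict proto-differentiability.\<close>

definition strictly_differentiable ::
  "('a::real_normed_vector \<Rightarrow> 'b::real_normed_vector) \<Rightarrow> ('a \<Rightarrow>\<^sub>L 'b) \<Rightarrow> 'a \<Rightarrow> bool" where
  "strictly_differentiable g D z \<longleftrightarrow>
     (\<forall>\<epsilon>>0. \<exists>\<delta>>0. \<forall>x\<in>ball z \<delta>. \<forall>y\<in>ball z \<delta>. norm (g y - g x - D (y - x)) \<le> \<epsilon> * norm (y - x))"

lemma strictly_differentiableD:
  assumes "strictly_differentiable g D z" "0 < \<epsilon>"
  obtains \<delta> where "\<delta> > 0" "\<And>x y. x \<in> ball z \<delta> \<Longrightarrow> y \<in> ball z \<delta> \<Longrightarrow>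
    norm (g y - g x - D (y - x)) \<le> \<epsilon> * norm (y - x)"
proof -
  obtain \<delta> where "\<delta> > 0" "\<forall>x\<in>ball z \<delta>. \<forall>y\<in>ball z \<delta>. norm (g y - g x - D (y - x)) \<le> \<epsilon> * norm (y - x)"
    using assms unfolding strictly_differentiable_def by blast
  then show thesis
    by (intro that[of \<delta>]) auto
qed

text \<open>Mean value inequality for \<open>g\<close> minus its linearisation at \<open>z\<close>,
  on a ball where continuity keeps \<open>g' x\<close> within \<epsilon> of
  \<open>g' z\<close>.\<close>

lemma strictly_differentiable_if_C1:
  fixes g :: "'a::real_normed_vector \<Rightarrow> 'b::real_normed_vector"
  assumes "open S" "z \<in> S" and der: "\<And>x. x \<in> S \<Longrightarrow> (g has_derivative blinfun_apply (g' x)) (at x)"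
    and cont: "continuous_on S g'"
  shows "strictly_differentiable g (g' z) z"
  unfolding strictly_differentiable_def
proof (intro allI impI)
  fix \<epsilon> :: real assume "0 < \<epsilon>"
  have "isCont g' z"
    using cont assms(1,2) by (simp add: continuous_on_eq_continuous_at)
  then obtain d where d: "d > 0" "\<And>x. dist x z < d \<Longrightarrow> dist (g' x) (g' z) < \<epsilon>"
    using \<open>0 < \<epsilon>\<close> unfolding continuous_at_eps_delta by blast
  obtain r where r: "r > 0" "ball z r \<subseteq> S"
    using assms(1,2) openE by blast
  define \<delta> where "\<delta> = min d r"
  have "norm (g y - g x - g' z (y - x)) \<le> \<epsilon> * norm (y - x)" if "x \<in> ball z \<delta>" "y \<in> ball z \<delta>" for x y
  proof -
    have "norm (g y - g x - g' z (y - x)) \<le> norm (y - x) * \<epsilon>"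
    proof (rule differentiable_bound_linearization)
      fix t :: real assume "t \<in> {0..1}"
      then have "(1 - t) *\<^sub>R x + t *\<^sub>R y \<in> ball z \<delta>"
        using that by (intro convexD[OF convex_ball]) auto
      then show "x + t *\<^sub>R (y - x) \<in> ball z \<delta>"
        by (simp add: algebra_simps)
    next
      fix x assume x: "x \<in> ball z \<delta>"
      then show "(g has_derivative blinfun_apply (g' x)) (at x within ball z \<delta>)"
        using r(2) by (intro has_derivative_at_withinI[OF der]) (auto simp: \<delta>_def)
      have "blinfun_apply (g' x) - blinfun_apply (g' z) = blinfun_apply (g' x - g' z)"
        by (simp add: fun_eq_iff blinfun.diff_left)
      moreover have "norm (g' x - g' z) < \<epsilon>"
        using x d(2)[of x] by (simp add: \<delta>_def dist_commute flip: dist_norm)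
      ultimately show "onorm (blinfun_apply (g' x) - blinfun_apply (g' z)) \<le> \<epsilon>"
        by (simp add: norm_blinfun.rep_eq)
    qed (use d(1) r(1) in \<open>auto simp: \<delta>_def\<close>)
    then show ?thesis by (simp add: mult.commute)
  qed
  then show "\<exists>\<delta>>0. \<forall>x\<in>ball z \<delta>. \<forall>y\<in>ball z \<delta>. norm (g y - g x - g' z (y - x)) \<le> \<epsilon> * norm (y - x)"
    using d(1) r(1) by (intro exI[of _ \<delta>]) (auto simp: \<delta>_def)
qed

lemma strictly_differentiable_imp_lipschitz_on_ball:
  assumes "strictly_differentiable g D z"
  obtains \<delta> where "\<delta> > 0" "(norm D + 1)-lipschitz_on (ball z \<delta>) g"
proof -
  obtain \<delta> where \<delta>: "\<delta> > 0" "\<And>x y. x \<in> ball z \<delta> \<Longrightarrow> y \<in> ball z \<delta> \<Longrightarrow>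
      norm (g y - g x - D (y - x)) \<le> 1 * norm (y - x)"
    using strictly_differentiableD[OF assms, of 1] by auto
  have "norm (g x - g y) \<le> (norm D + 1) * norm (x - y)" if "x \<in> ball z \<delta>" "y \<in> ball z \<delta>" for x y
  proof -
    have "norm (g x - g y) \<le> norm (g x - g y - D (x - y)) + norm (D (x - y))"
      by norm
    also have "\<dots> \<le> 1 * norm (x - y) + norm D * norm (x - y)"
      using that by (intro add_mono \<delta>(2) norm_blinfun)
    finally show ?thesis by (simp add: algebra_simps)
  qed
  then have "(norm D + 1)-lipschitz_on (ball z \<delta>) g"
    by (intro lipschitz_onI) (auto simp: dist_norm)
  then show thesis
    using that \<delta>(1) by blast
qed

text \<open>The chain rule for limits of difference quotients whose two end points both move towards
  \<open>z\<close>. It carries quotients between the graph of \<open>F\<close>, the graph of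
  \<open>f\<close> and the parameter space. The quotients converge and so are eventually bounded,
  hence the linearisation error tends to 0.\<close>

lemma tendsto_strict_difference_quotient:
  assumes g: "strictly_differentiable g D z"
    and lim: "(x \<longlongrightarrow> z) G" "(y \<longlongrightarrow> z) G" "((\<lambda>s. (y s - x s) /\<^sub>R t s) \<longlongrightarrow> w) G"
  shows "((\<lambda>s. (g (y s) - g (x s)) /\<^sub>R t s) \<longlongrightarrow> D w) G"
proof -
  let ?q = "\<lambda>s. (y s - x s) /\<^sub>R t s"
  have "((\<lambda>s. (g (y s) - g (x s)) /\<^sub>R t s - D (?q s)) \<longlongrightarrow> 0) G"
  proof (rule tendstoI)
    fix e :: real assume "e > 0"
    define N where "N = norm w + 1"
    have "N > 0"
      by (simp add: N_def add_nonneg_pos)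
    define \<epsilon> where "\<epsilon> = e / 2 / N"
    have "\<epsilon> > 0"
      using \<open>e > 0\<close> \<open>N > 0\<close> by (simp add: \<epsilon>_def)
    then obtain \<delta> where \<delta>: "\<delta> > 0" "\<And>x y. x \<in> ball z \<delta> \<Longrightarrow> y \<in> ball z \<delta> \<Longrightarrow>
        norm (g y - g x - D (y - x)) \<le> \<epsilon> * norm (y - x)"
      using strictly_differentiableD[OF g] by metis
    have "\<forall>\<^sub>F s in G. dist (x s) z < \<delta>" "\<forall>\<^sub>F s in G. dist (y s) z < \<delta>"
      using lim \<delta>(1) by (auto dest: tendstoD)
    moreover have "\<forall>\<^sub>F s in G. norm (?q s) < N"
      using order_tendstoD(2)[OF tendsto_norm[OF lim(3)]] by (simp add: N_def)
    ultimately show "\<forall>\<^sub>F s in G. dist ((g (y s) - g (x s)) /\<^sub>R t s - D (?q s)) 0 < e"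
    proof eventually_elim
      case (elim s)
      have "(g (y s) - g (x s)) /\<^sub>R t s - D (?q s) = (g (y s) - g (x s) - D (y s - x s)) /\<^sub>R t s"
        by (simp add: blinfun.scaleR_right flip: scaleR_diff_right)
      then have "norm ((g (y s) - g (x s)) /\<^sub>R t s - D (?q s)) = norm (g (y s) - g (x s) - D (y s - x s)) / \<bar>t s\<bar>"
        by (simp add: divide_inverse_commute)
      also have "\<dots> \<le> \<epsilon> * norm (y s - x s) / \<bar>t s\<bar>"
        using elim by (intro divide_right_mono \<delta>(2)) (auto simp: dist_commute)
      also have "\<dots> = \<epsilon> * norm (?q s)"
        by (simp add: divide_inverse_commute)
      also have "\<dots> \<le> \<epsilon> * N"
        using elim \<open>\<epsilon> > 0\<close> by (intro mult_left_mono) auto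
      also have "\<dots> < e"
        using \<open>e > 0\<close> \<open>N > 0\<close> by (simp add: \<epsilon>_def)
      finally show ?case by simp
    qed
  qed
  from tendsto_add[OF this blinfun.tendsto[OF tendsto_const[of D] lim(3)]] show ?thesis
    by simp
qed


section \<open>Painleve--Kuratowski limits\<close>

lemma PK_lower_limit_subset_upper_limit:
  assumes "G \<noteq> bot"
  shows "PK_lower_limit G C \<subseteq> PK_upper_limit G C"
proof
  fix w assume "w \<in> PK_lower_limit G C"
  then have "Liminf G (\<lambda>s. ereal (infdist w (C s))) \<le> 0"
    using Liminf_le_Limsup[OF assms, of "\<lambda>s. ereal (infdist w (C s))"] by (simp add: PK_lower_limit_def)
  moreover have "0 \<le> Liminf G (\<lambda>s. ereal (infdist w (C s)))"
    by (intro Liminf_bounded always_eventually) (simp add: infdist_nonneg)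
  ultimately show "w \<in> PK_upper_limit G C"
    by (simp add: PK_upper_limit_def)
qed

lemma PK_upper_limit_frequently:
  assumes w: "w \<in> PK_upper_limit G C" and "0 < \<epsilon>"
  shows "\<exists>\<^sub>F s in G. infdist w (C s) < \<epsilon>"
proof (rule ccontr)
  assume "\<not> ?thesis"
  then have "\<forall>\<^sub>F s in G. ereal \<epsilon> \<le> ereal (infdist w (C s))"
    by (simp add: not_frequently not_less)
  then have "ereal \<epsilon> \<le> Liminf G (\<lambda>s. ereal (infdist w (C s)))"
    by (rule Liminf_bounded)
  then show False
    using w \<open>0 < \<epsilon>\<close> by (simp add: PK_upper_limit_def)
qed

lemma PK_lower_limitI:
  assumes "G \<noteq> bot" "((\<lambda>s. infdist w (C s)) \<longlongrightarrow> 0) G"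
  shows "w \<in> PK_lower_limit G C"
proof -
  have "((\<lambda>s. ereal (infdist w (C s))) \<longlongrightarrow> ereal 0) G"
    using assms(2) by (rule tendsto_ereal)
  from lim_imp_Limsup[OF assms(1) this] show ?thesis
    by (simp add: PK_lower_limit_def zero_ereal_def)
qed

text \<open>Nonemptiness matters because \<open>infdist x {}\<close> is 0.\<close>

lemma infdist_lessE:
  assumes "infdist x A < e" "A \<noteq> {}"
  obtains a where "a \<in> A" "dist x a < e"
proof -
  have "(INF a\<in>A. dist x a) < e"
    using assms by (simp add: infdist_notempty)
  then have "\<exists>a\<in>A. dist x a < e"
    using assms(2) by (subst (asm) cINF_less_iff) (auto intro!: bdd_belowI[of _ 0])
  then show thesis
    using that by blast
qed

lemma LIMSEQ_if_dist_less_inverse_Suc: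
  fixes a :: "nat \<Rightarrow> 'a::metric_space"
  assumes "\<And>k. dist (a k) b < inverse (real (Suc k))"
  shows "a \<longlonglongrightarrow> b"
  by (rule metric_tendsto_imp_tendsto[OF LIMSEQ_inverse_real_of_nat])
    (use assms in \<open>auto intro!: always_eventually less_imp_le simp del: of_nat_Suc\<close>)

lemma graph_quotient_filter_neq_bot:
  assumes "z \<in> S"
  shows "inf (nhds z) (principal S) \<times>\<^sub>F at_right (0::real) \<noteq> bot"
proof -
  have "inf (nhds z) (principal S) \<noteq> bot"
  proof
    assume "inf (nhds z) (principal S) = bot"
    then have "\<forall>\<^sub>F x in nhds z. x \<notin> S"
      by (simp add: trivial_limit_def eventually_inf_principal)
    then show False
      using eventually_nhds_x_imp_x assms by blast
  qed
  then show ?thesis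
    by (simp add: prod_filter_eq_bot)
qed


section \<open>Graphs in a Lipschitz chart\<close>

text \<open>The chart \<Phi> from \<open>W\<close> to \<open>V\<close> with its inverse \<Psi>. Both
  derivatives are named as elements of the operator space, so that their continuity is meant in the
  operator norm. The assumption \<open>dim_eq\<close> encodes that the graph has dimension
  n.\<close>

locale graph_chart =
  fixes F :: "'a::euclidean_space \<Rightarrow> 'b::euclidean_space set"
    and \<Phi> :: "'a \<times> 'b \<Rightarrow> 'd::euclidean_space \<times> 'e::euclidean_space" and \<Phi>' W
    and \<Psi> :: "'d \<times> 'e \<Rightarrow> 'a \<times> 'b" and \<Psi>' V
    and f :: "'d \<Rightarrow> 'e" and U C
  assumes dim_eq: "DIM('d) = DIM('a)"
    and open_W: "open W" and open_V: "open V" and open_U: "open U"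
    and \<Phi>_V: "z \<in> W \<Longrightarrow> \<Phi> z \<in> V" and \<Psi>_W: "p \<in> V \<Longrightarrow> \<Psi> p \<in> W"
    and \<Psi>_\<Phi>: "z \<in> W \<Longrightarrow> \<Psi> (\<Phi> z) = z" and \<Phi>_\<Psi>: "p \<in> V \<Longrightarrow> \<Phi> (\<Psi> p) = p"
    and \<Phi>_deriv: "z \<in> W \<Longrightarrow> (\<Phi> has_derivative blinfun_apply (\<Phi>' z)) (at z)"
    and \<Psi>_deriv: "p \<in> V \<Longrightarrow> (\<Psi> has_derivative blinfun_apply (\<Psi>' p)) (at p)"
    and \<Phi>'_cont: "continuous_on W \<Phi>'" and \<Psi>'_cont: "continuous_on V \<Psi>'"
    and f_lipschitz: "C-lipschitz_on U f"
    and graph: "\<Phi> ` (gph F \<inter> W) = {(u, f u) |u. u \<in> U}"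
begin

text \<open>For the converse direction, \<open>\<Phi> z\<close> is also the image of some point of
  \<open>gph F\<close> in \<open>W\<close>, and the left inverse \<Psi> identifies that point with
  \<open>z\<close>.\<close>

lemma gph_iff: "z \<in> W \<Longrightarrow> z \<in> gph F \<longleftrightarrow> fst (\<Phi> z) \<in> U \<and> snd (\<Phi> z) = f (fst (\<Phi> z))"
proof
  assume "z \<in> W" "z \<in> gph F"
  then have "\<Phi> z \<in> {(u, f u) |u. u \<in> U}"
    using graph by blast
  then show "fst (\<Phi> z) \<in> U \<and> snd (\<Phi> z) = f (fst (\<Phi> z))"
    by auto
next
  assume z: "z \<in> W" "fst (\<Phi> z) \<in> U \<and> snd (\<Phi> z) = f (fst (\<Phi> z))"
  then have "\<Phi> z \<in> \<Phi> ` (gph F \<inter> W)"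
    unfolding graph by (auto simp: prod_eq_iff)
  then obtain z' where z': "z' \<in> gph F" "z' \<in> W" "\<Phi> z = \<Phi> z'"
    by auto
  have "z = \<Psi> (\<Phi> z')"
    using \<Psi>_\<Phi>[OF z(1)] z'(3) by simp
  also have "\<dots> = z'"
    by (rule \<Psi>_\<Phi>[OF z'(2)])
  finally show "z \<in> gph F"
    using z'(1) by simp
qed

lemma graph_in_V:
  assumes "u \<in> U"
  shows "(u, f u) \<in> V"
proof -
  have "(u, f u) \<in> \<Phi> ` (gph F \<inter> W)"
    unfolding graph using assms by blast
  then show ?thesis
    using \<Phi>_V by auto
qed

text \<open>Parametrises \<open>gph F \<inter> W\<close> over \<open>U\<close>, with
  \<open>fst \<circ> \<Phi>\<close> as inverse.\<close>

definition \<gamma> :: "'d \<Rightarrow> 'a \<times> 'b" where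
  "\<gamma> u = \<Psi> (u, f u)"

lemma \<gamma>_W: "u \<in> U \<Longrightarrow> \<gamma> u \<in> W"
  by (simp add: \<gamma>_def \<Psi>_W graph_in_V)

lemma \<Phi>_\<gamma>: "u \<in> U \<Longrightarrow> \<Phi> (\<gamma> u) = (u, f u)"
  by (simp add: \<gamma>_def \<Phi>_\<Psi> graph_in_V)

lemma \<gamma>_gph: "u \<in> U \<Longrightarrow> \<gamma> u \<in> gph F"
  by (simp add: gph_iff \<gamma>_W \<Phi>_\<gamma>)

lemma \<gamma>_fst_\<Phi>:
  assumes "z \<in> gph F" "z \<in> W"
  shows "\<gamma> (fst (\<Phi> z)) = z"
proof -
  have "(fst (\<Phi> z), f (fst (\<Phi> z))) = \<Phi> z"
    using gph_iff[OF assms(2)] assms(1) by (simp add: prod_eq_iff)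
  then show ?thesis
    by (simp add: \<gamma>_def \<Psi>_\<Phi>[OF assms(2)])
qed

lemma C_nonneg: "0 \<le> C"
  by (rule lipschitz_on_nonneg[OF f_lipschitz])

lemma f_continuous: "continuous_on U f"
  by (rule lipschitz_on_continuous_on[OF f_lipschitz])

lemma \<gamma>_continuous: "continuous_on U \<gamma>"
proof -
  have "continuous_on V \<Psi>"
    by (intro continuous_at_imp_continuous_on ballI has_derivative_continuous[OF \<Psi>_deriv])
  then show ?thesis
    unfolding \<gamma>_def
    by (rule continuous_on_compose2) (auto intro!: continuous_intros f_continuous graph_in_V)
qed

section \<open>First-order behaviour of the chart and slopes of tangent vectors\<close>

lemma \<Phi>_strict: "z \<in> W \<Longrightarrow> strictly_differentiable \<Phi> (\<Phi>' z) z"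
  by (rule strictly_differentiable_if_C1[OF open_W _ \<Phi>_deriv \<Phi>'_cont])

lemma \<Psi>_strict: "p \<in> V \<Longrightarrow> strictly_differentiable \<Psi> (\<Psi>' p) p"
  by (rule strictly_differentiable_if_C1[OF open_V _ \<Psi>_deriv \<Psi>'_cont])

lemma \<Psi>'_\<Phi>': "z \<in> W \<Longrightarrow> \<Psi>' (\<Phi> z) (\<Phi>' z w) = w"
proof -
  assume z: "z \<in> W"
  have "((\<Psi> \<circ> \<Phi>) has_derivative (blinfun_apply (\<Psi>' (\<Phi> z)) \<circ> blinfun_apply (\<Phi>' z))) (at z)"
    using z by (intro diff_chain_at \<Phi>_deriv \<Psi>_deriv \<Phi>_V)
  moreover have "((\<Psi> \<circ> \<Phi>) has_derivative id) (at z)"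
    by (rule has_derivative_transform_within_open[OF has_derivative_id open_W z]) (simp add: \<Psi>_\<Phi>)
  ultimately have "blinfun_apply (\<Psi>' (\<Phi> z)) \<circ> blinfun_apply (\<Phi>' z) = id"
    by (rule has_derivative_unique)
  then show ?thesis
    by (metis comp_apply id_apply)
qed

lemma \<Phi>'_\<Psi>': "p \<in> V \<Longrightarrow> \<Phi>' (\<Psi> p) (\<Psi>' p q) = q"
proof -
  assume p: "p \<in> V"
  have "((\<Phi> \<circ> \<Psi>) has_derivative (blinfun_apply (\<Phi>' (\<Psi> p)) \<circ> blinfun_apply (\<Psi>' p))) (at p)"
    using p by (intro diff_chain_at \<Phi>_deriv \<Psi>_deriv \<Psi>_W)
  moreover have "((\<Phi> \<circ> \<Psi>) has_derivative id) (at p)"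
    by (rule has_derivative_transform_within_open[OF has_derivative_id open_V p]) (simp add: \<Phi>_\<Psi>)
  ultimately have "blinfun_apply (\<Phi>' (\<Psi> p)) \<circ> blinfun_apply (\<Psi>' p) = id"
    by (rule has_derivative_unique)
  then show ?thesis
    by (metis comp_apply id_apply)
qed

text \<open>A tangent vector is a limit of difference quotients of the graph of \<open>F\<close>.
  Applying \<Phi> turns these into difference quotients of the graph of \<open>f\<close>, which have
  slope at most \<open>C\<close>, and the bound passes to the limit.\<close>

lemma tangent_cone_slope:
  assumes z: "z \<in> gph F" "z \<in> W" and w: "w \<in> tangent_cone (gph F) z"
  shows "norm (snd (\<Phi>' z w)) \<le> C * norm (fst (\<Phi>' z w))"
proof -
  obtain t w' where t: "\<And>k. t k > 0" "t \<longlonglongrightarrow> 0" and w': "w' \<longlonglongrightarrow> w" "\<And>k. z + t k *\<^sub>R w' k \<in> gph F"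
    using w unfolding tangent_cone_def by blast
  define y where "y k = z + t k *\<^sub>R w' k" for k
  have y: "y \<longlonglongrightarrow> z"
    using tendsto_add[OF tendsto_const tendsto_scaleR[OF t(2) w'(1)], of z] by (simp add: y_def[abs_def])
  have "(\<lambda>k. (y k - z) /\<^sub>R t k) = w'"
  proof
    fix k
    have "t k \<noteq> 0"
      using t(1)[of k] by simp
    then show "(y k - z) /\<^sub>R t k = w' k"
      by (simp add: y_def)
  qed
  then have lim: "(\<lambda>k. (\<Phi> (y k) - \<Phi> z) /\<^sub>R t k) \<longlonglongrightarrow> \<Phi>' z w"
    using w'(1) y by (intro tendsto_strict_difference_quotient[OF \<Phi>_strict[OF z(2)]] tendsto_const) auto
  show ?thesis
  proof (rule tendsto_le[OF trivial_limit_sequentially])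
    show "(\<lambda>k. norm (snd ((\<Phi> (y k) - \<Phi> z) /\<^sub>R t k))) \<longlonglongrightarrow> norm (snd (\<Phi>' z w))"
      by (intro tendsto_intros lim)
    show "(\<lambda>k. C * norm (fst ((\<Phi> (y k) - \<Phi> z) /\<^sub>R t k))) \<longlonglongrightarrow> C * norm (fst (\<Phi>' z w))"
      by (intro tendsto_intros lim)
    have "\<forall>\<^sub>F k in sequentially. y k \<in> W"
      by (rule topological_tendstoD[OF y open_W z(2)])
    then show "\<forall>\<^sub>F k in sequentially. norm (snd ((\<Phi> (y k) - \<Phi> z) /\<^sub>R t k)) \<le> C * norm (fst ((\<Phi> (y k) - \<Phi> z) /\<^sub>R t k))"
    proof eventually_elim
      case (elim k)
      have "norm (snd (\<Phi> (y k)) - snd (\<Phi> z)) \<le> C * norm (fst (\<Phi> (y k)) - fst (\<Phi> z))"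
        using lipschitz_onD[OF f_lipschitz, of "fst (\<Phi> (y k))" "fst (\<Phi> z)"] w'(2)[of k] elim z
          gph_iff[of z] gph_iff[of "y k"]
        by (simp add: dist_norm y_def)
      then have "inverse \<bar>t k\<bar> * norm (snd (\<Phi> (y k)) - snd (\<Phi> z))
          \<le> inverse \<bar>t k\<bar> * (C * norm (fst (\<Phi> (y k)) - fst (\<Phi> z)))"
        by (rule mult_left_mono) simp
      then show ?case
        by (simp add: mult.left_commute)
    qed
  qed
qed

text \<open>The slope bound for tangent cones at smooth points passes to limiting subspaces:
  \<open>l\<close> is the limit of its projections to the tangent spaces at \<open>zk k\<close>, and
  \<open>\<Phi>'\<close> is continuous.\<close>

lemma SC_derivative_slope:
  assumes z: "z \<in> gph F" "z \<in> W" and L: "L \<in> SC_derivative F z" "l \<in> L"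
  shows "norm (snd (\<Phi>' z l)) \<le> C * norm (fst (\<Phi>' z l))"
proof -
  obtain zk where zk: "\<And>k. zk k \<in> smooth_points F" "zk \<longlonglongrightarrow> z"
    and dist: "(\<lambda>k. subspace_dist L (tangent_cone (gph F) (zk k))) \<longlonglongrightarrow> 0" and "subspace L"
    using L(1) unfolding SC_derivative_def Zspace_def by blast
  define T where "T k = tangent_cone (gph F) (zk k)" for k
  have T: "subspace (T k)" "zk k \<in> gph F" for k
    using zk(1)[of k] by (auto simp: smooth_points_def Zspace_def T_def)
  define lk where "lk k = orth_projection (T k) l" for k
  have le: "norm (lk k - l) \<le> subspace_dist L (T k) * norm l" for k
  proof -
    \<comment> \<open>As \<open>l\<close> is its own projection to \<open>L\<close>, the subspace
      distance controls how far \<open>lk k\<close> is from it.\<close>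
    have "orth_projection L l = l"
      using L(2) \<open>subspace L\<close> by (intro orth_projection_eqI) (auto simp: subspace_0 subspace_orthogonal_comp)
    then show ?thesis
      using norm_orth_projection_diff_le_subspace_dist[OF \<open>subspace L\<close> T(1)[of k], of l]
      by (simp add: lk_def norm_minus_commute)
  qed
  have "(\<lambda>k. subspace_dist L (T k) * norm l) \<longlonglongrightarrow> 0"
    using tendsto_mult_left_zero[OF dist] unfolding T_def .
  then have "(\<lambda>k. lk k - l) \<longlonglongrightarrow> 0"
    by (rule Lim_null_comparison[OF always_eventually[OF allI[OF le]]])
  then have lk: "lk \<longlonglongrightarrow> l"
    by (simp add: LIM_zero_iff)
  have "isCont \<Phi>' z"
    using \<Phi>'_cont open_W z(2) by (simp add: continuous_on_eq_continuous_at)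
  then have "(\<lambda>k. \<Phi>' (zk k)) \<longlonglongrightarrow> \<Phi>' z"
    by (rule isCont_tendsto_compose[OF _ zk(2)])
  then have lim: "(\<lambda>k. \<Phi>' (zk k) (lk k)) \<longlonglongrightarrow> \<Phi>' z l"
    using lk by (intro blinfun.tendsto)
  show ?thesis
  proof (rule tendsto_le[OF trivial_limit_sequentially])
    show "(\<lambda>k. norm (snd (\<Phi>' (zk k) (lk k)))) \<longlonglongrightarrow> norm (snd (\<Phi>' z l))"
      by (intro tendsto_intros lim)
    show "(\<lambda>k. C * norm (fst (\<Phi>' (zk k) (lk k)))) \<longlonglongrightarrow> C * norm (fst (\<Phi>' z l))"
      by (intro tendsto_intros lim)
    have "\<forall>\<^sub>F k in sequentially. zk k \<in> W"
      by (rule topological_tendstoD[OF zk(2) open_W z(2)])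
    then show "\<forall>\<^sub>F k in sequentially. norm (snd (\<Phi>' (zk k) (lk k))) \<le> C * norm (fst (\<Phi>' (zk k) (lk k)))"
    proof eventually_elim
      case (elim k)
      then show ?case
        using T orth_projection_mem[OF T(1)] by (intro tangent_cone_slope) (auto simp: lk_def T_def)
    qed
  qed
qed

section \<open>Limiting subspaces as linear maps\<close>

text \<open>Pulls the graph of \<open>A\<close>, a candidate tangent space of the graph of \<open>f\<close>, back through the chart.\<close>

definition para :: "'d \<Rightarrow> ('d \<Rightarrow>\<^sub>L 'e) \<Rightarrow> 'd \<Rightarrow>\<^sub>L ('a \<times> 'b)" where
  "para u A = \<Psi>' (u, f u) o\<^sub>L Blinfun (\<lambda>v. (v, A v))"

lemma para_apply: "para u A v = \<Psi>' (u, f u) (v, A v)"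
  unfolding para_def blinfun_apply_blinfun_compose
  by (subst bounded_linear_Blinfun_apply)
    (intro bounded_linear_Pair bounded_linear_ident blinfun.bounded_linear_right refl)+

lemma \<Phi>'_para: "u \<in> U \<Longrightarrow> \<Phi>' (\<gamma> u) (para u A v) = (v, A v)"
  by (simp add: \<gamma>_def para_apply \<Phi>'_\<Psi>' graph_in_V)

lemma inj_para: "u \<in> U \<Longrightarrow> inj (para u A)"
  by (rule injI) (metis \<Phi>'_para prod.inject)

text \<open>For linear maps on a Euclidean space, convergence at each vector gives convergence in
  norm.\<close>

lemma tendsto_para:
  assumes "\<And>k. v k \<in> U" "v \<longlonglongrightarrow> u" "u \<in> U" "G \<longlonglongrightarrow> A"
  shows "(\<lambda>k. para (v k) (G k)) \<longlonglongrightarrow> para u A"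
proof (rule tendsto_componentwise1)
  fix j
  have "(\<lambda>k. f (v k)) \<longlonglongrightarrow> f u"
    using assms by (intro continuous_on_tendsto_compose[OF f_continuous]) auto
  then have "(\<lambda>k. \<Psi>' (v k, f (v k))) \<longlonglongrightarrow> \<Psi>' (u, f u)"
    using assms graph_in_V by (intro continuous_on_tendsto_compose[OF \<Psi>'_cont] tendsto_Pair) auto
  then show "(\<lambda>k. para (v k) (G k) j) \<longlonglongrightarrow> para u A j"
    unfolding para_apply by (intro tendsto_intros assms)
qed

text \<open>The SC derivative at \<open>\<gamma> u\<close> read in the chart: its elements are
  exactly the ranges of \<open>para u A\<close> for \<open>A\<close> in this set, because each of
  them becomes the graph of a linear map.\<close>

definition B :: "'d \<Rightarrow> ('d \<Rightarrow>\<^sub>L 'e) set" where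
  "B u = {A. range (para u A) \<in> SC_derivative F (\<gamma> u)}"

lemma norm_B_le:
  assumes "u \<in> U" "A \<in> B u"
  shows "norm A \<le> C"
proof (rule norm_blinfun_bound)
  fix v
  have "norm (snd (\<Phi>' (\<gamma> u) (para u A v))) \<le> C * norm (fst (\<Phi>' (\<gamma> u) (para u A v)))"
    using assms by (intro SC_derivative_slope[of _ "range (para u A)"]) (auto simp: \<gamma>_gph \<gamma>_W B_def)
  then show "norm (A v) \<le> C * norm v"
    using assms by (simp add: \<Phi>'_para)
qed (rule C_nonneg)

text \<open>By the slope bound, a vector of \<open>L\<close> whose chart image has first component 0
  is itself 0. So \<open>h\<close> is injective on \<open>L\<close>, and as \<open>L\<close> has the
  dimension of the parameter space, also onto: the chart image of \<open>L\<close> is the graph of a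
  linear map.\<close>

lemma SC_derivative_eq_range_para:
  assumes u: "u \<in> U" and L: "L \<in> SC_derivative F (\<gamma> u)"
  obtains A where "A \<in> B u" "L = range (para u A)"
proof -
  have "subspace L" and dim: "dim L = DIM('a)"
    using L by (auto simp: SC_derivative_def Zspace_def)
  define h where "h l = fst (\<Phi>' (\<gamma> u) l)" for l
  have slope: "norm (snd (\<Phi>' (\<gamma> u) l)) \<le> C * norm (h l)" if "l \<in> L" for l
    unfolding h_def using u L that by (intro SC_derivative_slope) (auto simp: \<gamma>_gph \<gamma>_W)
  have "bounded_linear h"
    unfolding h_def by (intro bounded_linear_fst_comp blinfun.bounded_linear_right)
  then have h: "linear h"
    by (rule bounded_linear.linear)
  have \<Psi>'_h: "\<Psi>' (u, f u) (h l, snd (\<Phi>' (\<gamma> u) l)) = l" for l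
    using \<Psi>'_\<Phi>'[OF \<gamma>_W[OF u], of l] u by (simp add: h_def \<Phi>_\<gamma>)
  have "inj_on h L"
  proof (rule linear_inj_on_iff_eq_0[OF h \<open>subspace L\<close>, THEN iffD2], intro ballI impI)
    fix l assume "l \<in> L" "h l = 0"
    then have "snd (\<Phi>' (\<gamma> u) l) = 0"
      using slope[of l] by simp
    then show "l = 0"
      using \<Psi>'_h[of l] \<open>h l = 0\<close> by (simp flip: zero_prod_def)
  qed
  then obtain g where g: "linear g" "\<And>l. l \<in> L \<Longrightarrow> g (h l) = l"
    using linear_exists_left_inverse_on[OF h \<open>subspace L\<close>] by blast
  have "subspace (h ` L)"
    using linear_subspace_image[OF h \<open>subspace L\<close>] .
  moreover have "dim (h ` L) = DIM('d)"
    using dim_image_eq[OF h, of L] \<open>inj_on h L\<close> \<open>subspace L\<close> dim dim_eq by (simp add: span_eq_iff[THEN iffD2])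
  ultimately have surj: "h ` L = UNIV"
    using dim_eq_full[of "h ` L"] by (simp add: span_eq_iff[THEN iffD2])
  define A where "A = Blinfun (\<lambda>v. snd (\<Phi>' (\<gamma> u) (g v)))"
  have "bounded_linear (\<lambda>v. snd (\<Phi>' (\<gamma> u) (g v)))"
    using g(1) by (intro bounded_linear_snd_comp bounded_linear_compose[OF blinfun.bounded_linear_right])
      (simp add: linear_conv_bounded_linear)
  then have A: "A v = snd (\<Phi>' (\<gamma> u) (g v))" for v
    by (simp add: A_def bounded_linear_Blinfun_apply)
  have para_h: "para u A (h l) = l" if "l \<in> L" for l
    using that g(2) \<Psi>'_h by (simp add: para_apply A)
  have "L = range (para u A)"
  proof
    show "L \<subseteq> range (para u A)"
      using para_h by (metis rangeI subsetI)
    show "range (para u A) \<subseteq> L"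
    proof
      fix l assume "l \<in> range (para u A)"
      then obtain v where "l = para u A v" by blast
      moreover obtain l' where "l' \<in> L" "v = h l'"
        using surj by blast
      ultimately show "l \<in> L"
        using para_h by simp
    qed
  qed
  then show thesis
    using that L by (simp add: B_def)
qed

text \<open>A diagonal choice: for each \<open>k\<close> take a smooth point within 1/(k+1) of
  \<open>\<gamma> (v k)\<close> whose tangent space is within 1/(k+1) of \<open>L k\<close>. Since
  \<open>L k\<close> converges to the range of \<open>para u A\<close>, so do these tangent
  spaces.\<close>

lemma B_closed_graph:
  assumes v: "\<And>k. v k \<in> U" "v \<longlonglongrightarrow> u" "u \<in> U" and G: "\<And>k. G k \<in> B (v k)" "G \<longlonglongrightarrow> A"
  shows "A \<in> B u"
proof -
  define L where "L k = range (para (v k) (G k))" for k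
  define T where "T z = tangent_cone (gph F) z" for z
  have "\<exists>z. z \<in> smooth_points F \<and> dist z (\<gamma> (v k)) < inverse (real (Suc k)) \<and> subspace_dist (L k) (T z) < inverse (real (Suc k))" for k
  proof -
    obtain zk where zk: "\<And>i. zk i \<in> smooth_points F" "zk \<longlonglongrightarrow> \<gamma> (v k)"
      "(\<lambda>i. subspace_dist (L k) (T (zk i))) \<longlonglongrightarrow> 0"
      using G(1)[of k] unfolding B_def SC_derivative_def L_def T_def by blast
    have "\<forall>\<^sub>F i in sequentially. dist (zk i) (\<gamma> (v k)) < inverse (real (Suc k))"
      using zk(2) by (intro tendstoD) auto
    moreover have "\<forall>\<^sub>F i in sequentially. subspace_dist (L k) (T (zk i)) < inverse (real (Suc k))"
      using zk(3) by (intro order_tendstoD) auto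
    ultimately have "\<forall>\<^sub>F i in sequentially. dist (zk i) (\<gamma> (v k)) < inverse (real (Suc k))
        \<and> subspace_dist (L k) (T (zk i)) < inverse (real (Suc k))"
      by (rule eventually_conj)
    then obtain i where "dist (zk i) (\<gamma> (v k)) < inverse (real (Suc k))" "subspace_dist (L k) (T (zk i)) < inverse (real (Suc k))"
      using eventually_happens' sequentially_bot by blast
    then show ?thesis
      using zk(1) by blast
  qed
  then obtain z where z: "\<And>k. z k \<in> smooth_points F" "\<And>k. dist (z k) (\<gamma> (v k)) < inverse (real (Suc k))"
    "\<And>k. subspace_dist (L k) (T (z k)) < inverse (real (Suc k))"
    by metis
  define L0 where "L0 = range (para u A)"
  have sub: "subspace L0" "subspace (L k)" "subspace (T (z k))" for k
    using z(1)[of k] by (auto simp: L0_def L_def T_def subspace_range_blinfun smooth_points_def Zspace_def)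
  have "(\<lambda>k. z k - \<gamma> (v k)) \<longlonglongrightarrow> 0"
    using z(2) by (intro Lim_null_comparison[OF _ LIMSEQ_inverse_real_of_nat] always_eventually)
      (auto simp: dist_norm less_imp_le)
  moreover have "(\<lambda>k. \<gamma> (v k)) \<longlonglongrightarrow> \<gamma> u"
    using v by (intro continuous_on_tendsto_compose[OF \<gamma>_continuous]) auto
  ultimately have z_lim: "z \<longlonglongrightarrow> \<gamma> u"
    by (rule Lim_transform[rotated])
  have "(\<lambda>k. subspace_dist L0 (L k)) \<longlonglongrightarrow> 0"
    unfolding L0_def L_def using v G(2) by (intro tendsto_subspace_dist_range tendsto_para inj_para)
  then have lim: "(\<lambda>k. subspace_dist L0 (L k) + inverse (real (Suc k))) \<longlonglongrightarrow> 0"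
    using tendsto_add[OF _ LIMSEQ_inverse_real_of_nat] by fastforce
  have le: "norm (subspace_dist L0 (T (z k))) \<le> subspace_dist L0 (L k) + inverse (real (Suc k))" for k
    using subspace_dist_triangle[OF sub(1) sub(2)[of k] sub(3)[of k]] z(3)[of k]
      subspace_dist_nonneg[OF sub(1) sub(3)[of k]]
    unfolding real_norm_def by linarith
  have "(\<lambda>k. subspace_dist L0 (T (z k))) \<longlonglongrightarrow> 0"
    by (rule Lim_null_comparison[OF always_eventually[OF allI[OF le]] lim])
  moreover have "L0 \<in> Zspace"
    unfolding L0_def using inj_para v(3) dim_eq by (intro range_blinfun_in_Zspace)
  ultimately have "L0 \<in> SC_derivative F (\<gamma> u)"
    using z(1) z_lim by (auto simp: SC_derivative_def T_def)
  then show ?thesis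
    by (simp add: B_def L0_def)
qed

text \<open>The primal SCD-ss* estimate provides a vector \<open>para v A a\<close> close to
  \<open>z' - z\<close>. Its chart image is \<open>(a, A a)\<close>, that of the increment is
  \<open>(v - u, f v - f u)\<close> up to a linearisation error, so the two pairs nearly agree.
  Eliminating \<open>a\<close> with \<open>norm A \<le> C\<close> gives the claim.\<close>

lemma B_semismooth:
  assumes u: "u \<in> U" and ss: "SCD_ss_star_at F (\<gamma> u)" and "0 < \<epsilon>"
  shows "\<exists>\<delta>>0. \<forall>v\<in>U. norm (v - u) < \<delta> \<longrightarrow>
    (\<forall>A\<in>B v. norm (f v - f u - A (v - u)) \<le> \<epsilon> * norm (v - u))"
proof -
  define z where "z = \<gamma> u"
  have z: "z \<in> W" "\<Phi> z = (u, f u)"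
    using u by (simp_all add: z_def \<gamma>_W \<Phi>_\<gamma>)
  define K where "K = norm (\<Psi>' (u, f u)) + 1"
  \<comment> \<open>Collects the constants: \<open>1 + C\<close> from eliminating \<open>a\<close>,
    the middle factor from the three error terms in the chart, and \<open>K * (1 + C)\<close> from
    bounding \<open>r\<close> by \<open>norm (v - u)\<close>.\<close>
  define M where "M = (1 + C) * (3 + norm (\<Phi>' z)) * (K * (1 + C))"
  have "K > 0"
    by (simp add: K_def add_nonneg_pos)
  then have "M > 0"
    using C_nonneg by (auto simp: M_def intro!: mult_pos_pos add_pos_nonneg)
  \<comment> \<open>The bound 1 serves only to keep \<open>norm (\<Phi>' z')\<close> below
    \<open>norm (\<Phi>' z) + 1\<close>.\<close>
  define \<eta> where "\<eta> = min 1 (\<epsilon> / M)"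
  have \<eta>: "\<eta> > 0" "\<eta> \<le> 1" "\<eta> * M \<le> \<epsilon>"
    using \<open>0 < \<epsilon>\<close> \<open>M > 0\<close> by (auto simp: \<eta>_def min_def field_simps)
  obtain \<delta>1 where \<delta>1: "\<delta>1 > 0" "\<And>z' L. z' \<in> gph F \<Longrightarrow> norm (z' - z) \<le> \<delta>1 \<Longrightarrow> L \<in> SC_derivative F z' \<Longrightarrow>
      \<exists>l\<in>L. norm (z' - z - l) \<le> \<eta> * norm (z' - z)"
    using SCD_ss_star_at_near_subspace[OF ss \<eta>(1)] unfolding z_def by metis
  obtain \<delta>2 where \<delta>2: "\<delta>2 > 0" "\<And>x y. x \<in> ball z \<delta>2 \<Longrightarrow> y \<in> ball z \<delta>2 \<Longrightarrow>
      norm (\<Phi> y - \<Phi> x - \<Phi>' z (y - x)) \<le> \<eta> * norm (y - x)"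
    using strictly_differentiableD[OF \<Phi>_strict[OF z(1)] \<eta>(1)] by metis
  have "isCont \<Phi>' z"
    using \<Phi>'_cont open_W z(1) by (simp add: continuous_on_eq_continuous_at)
  then obtain \<delta>3 where \<delta>3: "\<delta>3 > 0" "\<And>x. dist x z < \<delta>3 \<Longrightarrow> dist (\<Phi>' x) (\<Phi>' z) < \<eta>"
    using \<eta>(1) unfolding continuous_at_eps_delta by blast
  obtain \<delta>4 where \<delta>4: "\<delta>4 > 0" "K-lipschitz_on (ball (u, f u) \<delta>4) \<Psi>"
    using strictly_differentiable_imp_lipschitz_on_ball[OF \<Psi>_strict[OF graph_in_V[OF u]]] unfolding K_def by blast
  define \<delta>' where "\<delta>' = min \<delta>1 (min \<delta>2 \<delta>3)"
  have "\<delta>' > 0"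
    using \<delta>1 \<delta>2 \<delta>3 by (simp add: \<delta>'_def)
  have "continuous_on U (\<lambda>v. (v, f v))"
    by (intro continuous_intros f_continuous)
  then obtain d1 where d1: "d1 > 0" "\<And>v. v \<in> U \<Longrightarrow> dist v u < d1 \<Longrightarrow> dist (v, f v) (u, f u) < \<delta>4"
    using u \<delta>4(1) unfolding continuous_on_iff by meson
  obtain d2 where d2: "d2 > 0" "\<And>v. v \<in> U \<Longrightarrow> dist v u < d2 \<Longrightarrow> dist (\<gamma> v) (\<gamma> u) < \<delta>'"
    using u \<gamma>_continuous \<open>\<delta>' > 0\<close> unfolding continuous_on_iff by meson
  have "norm (f v - f u - A (v - u)) \<le> \<epsilon> * norm (v - u)"
    if v: "v \<in> U" "norm (v - u) < min d1 d2" and A: "A \<in> B v" for v A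
  proof -
    define z' where "z' = \<gamma> v"
    have z': "dist z' z < \<delta>'" "\<Phi> z' = (v, f v)" "z' \<in> gph F"
      using v d2 by (auto simp: z'_def z_def dist_norm \<Phi>_\<gamma> \<gamma>_gph)
    define r where "r = norm (z' - z)"
    have "dist (f v) (f u) \<le> C * dist v u"
      using lipschitz_onD[OF f_lipschitz] v(1) u by blast
    then have le: "norm ((v, f v) - (u, f u)) \<le> (1 + C) * norm (v - u)"
      using norm_Pair_le[of "v - u" "f v - f u"] by (simp add: dist_norm algebra_simps)
    have "dist v u < d1"
      using v(2) by (simp add: dist_norm)
    then have "(v, f v) \<in> ball (u, f u) \<delta>4" "(u, f u) \<in> ball (u, f u) \<delta>4"
      using d1(2)[OF v(1)] \<delta>4(1) by (simp_all only: mem_ball dist_commute[of "(u, f u)" "(v, f v)"] dist_self)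
    then have "r \<le> K * norm ((v, f v) - (u, f u))"
      using lipschitz_onD[OF \<delta>4(2)] by (simp only: r_def z'_def z_def \<gamma>_def flip: dist_norm)
    also have "\<dots> \<le> K * ((1 + C) * norm (v - u))"
      using le \<open>K > 0\<close> by (intro mult_left_mono) auto
    finally have r: "r \<le> K * (1 + C) * norm (v - u)"
      by (simp add: mult.assoc)
    have "range (para v A) \<in> SC_derivative F z'"
      using A by (simp add: B_def z'_def)
    then obtain a where a: "norm (z' - z - para v A a) \<le> \<eta> * r"
      using \<delta>1(2)[of z' "range (para v A)"] z' by (auto simp: \<delta>'_def r_def dist_norm)
    define n where "n = z' - z - para v A a"
    have norm_\<Phi>': "norm (\<Phi>' z' - \<Phi>' z) \<le> \<eta>"
      using \<delta>3(2)[of z'] z'(1) by (simp add: \<delta>'_def dist_norm)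
    have "norm (\<Phi>' z') \<le> norm (\<Phi>' z) + norm (\<Phi>' z' - \<Phi>' z)"
      by norm
    then have norm_\<Phi>'2: "norm (\<Phi>' z') \<le> norm (\<Phi>' z) + 1"
      using norm_\<Phi>' \<eta>(2) by linarith
    have para: "\<Phi>' z' (para v A a) = (a, A a)"
      using \<Phi>'_para[OF v(1)] by (simp add: z'_def)
    have "(v - u - a, f v - f u - A a) = \<Phi> z' - \<Phi> z - \<Phi>' z' (para v A a)"
      by (simp add: z'(2) z(2) para)
    \<comment> \<open>Three errors: strict differentiability of \<Phi> at \<open>z\<close>,
      continuity of \<open>\<Phi>'\<close>, and the distance \<open>n\<close> of the increment from
      the subspace.\<close>
    also have "\<dots> = (\<Phi> z' - \<Phi> z - \<Phi>' z (z' - z)) - (\<Phi>' z' - \<Phi>' z) (z' - z) + \<Phi>' z' n"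
      by (simp add: n_def blinfun.diff_left blinfun.diff_right)
    finally have "(v - u - a, f v - f u - A a) = (\<Phi> z' - \<Phi> z - \<Phi>' z (z' - z)) - (\<Phi>' z' - \<Phi>' z) (z' - z) + \<Phi>' z' n" .
    then have "norm (v - u - a, f v - f u - A a)
        = norm ((\<Phi> z' - \<Phi> z - \<Phi>' z (z' - z)) - (\<Phi>' z' - \<Phi>' z) (z' - z) + \<Phi>' z' n)"
      by (rule arg_cong)
    also have "\<dots> \<le> norm (\<Phi> z' - \<Phi> z - \<Phi>' z (z' - z)) + norm ((\<Phi>' z' - \<Phi>' z) (z' - z)) + norm (\<Phi>' z' n)"
      by (rule order_trans[OF norm_triangle_ineq add_right_mono[OF norm_triangle_ineq4]])
    also have "\<dots> \<le> \<eta> * r + \<eta> * r + (norm (\<Phi>' z) + 1) * (\<eta> * r)"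
    proof (intro add_mono)
      show "norm (\<Phi> z' - \<Phi> z - \<Phi>' z (z' - z)) \<le> \<eta> * r"
        unfolding r_def using z'(1) \<delta>2(1) by (intro \<delta>2(2)) (auto simp: \<delta>'_def dist_commute)
      show "norm ((\<Phi>' z' - \<Phi>' z) (z' - z)) \<le> \<eta> * r"
        using order_trans[OF norm_blinfun mult_right_mono[OF norm_\<Phi>' norm_ge_zero]] by (simp add: r_def)
      show "norm (\<Phi>' z' n) \<le> (norm (\<Phi>' z) + 1) * (\<eta> * r)"
        using order_trans[OF norm_blinfun mult_mono[OF norm_\<Phi>'2 a[folded n_def]]] by simp
    qed
    finally have defect: "norm (v - u - a, f v - f u - A a) \<le> (3 + norm (\<Phi>' z)) * (\<eta> * r)"
      by (simp add: algebra_simps)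
    have "norm (f v - f u - A (v - u)) = norm ((f v - f u - A a) - A (v - u - a))"
      by (simp add: blinfun.diff_right)
    also have "\<dots> \<le> norm (f v - f u - A a) + norm (A (v - u - a))"
      by (rule norm_triangle_ineq4)
    also have "\<dots> \<le> norm (f v - f u - A a) + norm A * norm (v - u - a)"
      by (intro add_left_mono norm_blinfun)
    also have "\<dots> \<le> 1 * norm (v - u - a, f v - f u - A a) + C * norm (v - u - a, f v - f u - A a)"
      using norm_fst_le[of "v - u - a" "f v - f u - A a"] norm_snd_le[of "f v - f u - A a" "v - u - a"]
        norm_B_le[OF v(1) A] C_nonneg
      by (intro add_mono mult_mono) auto
    also have "\<dots> \<le> (1 + C) * ((3 + norm (\<Phi>' z)) * (\<eta> * r))"
      unfolding distrib_right[symmetric] using defect C_nonneg by (intro mult_left_mono) auto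
    also have "\<dots> \<le> (1 + C) * ((3 + norm (\<Phi>' z)) * (\<eta> * (K * (1 + C) * norm (v - u))))"
      using r C_nonneg \<eta>(1) by (intro mult_left_mono) auto
    also have "\<dots> = \<eta> * M * norm (v - u)"
      by (simp add: M_def)
    also have "\<dots> \<le> \<epsilon> * norm (v - u)"
      using \<eta>(3) by (intro mult_right_mono) auto
    finally show ?thesis .
  qed
  then show ?thesis
    using d1(1) d2(1) by (intro exI[of _ "min d1 d2"]) auto
qed

text \<open>Both limits equal the range of \<open>para u A\<close>. Limits of quotients of
  \<open>gph F\<close> go through \<Phi> to limits of quotients of \<open>f\<close>, which lie in
  the graph of \<open>A\<close>; conversely every vector of the range is approximated from each
  nearby base point by shifting its parameter.\<close>

theorem strictly_proto_differentiable_if_strictly_differentiable: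
  assumes u: "u \<in> U" and f: "strictly_differentiable f A u"
  shows "strictly_proto_differentiable F (\<gamma> u)"
proof -
  define z where "z = \<gamma> u"
  have z: "z \<in> W" "z \<in> gph F" "\<Phi> z = (u, f u)"
    using u by (simp_all add: z_def \<gamma>_W \<gamma>_gph \<Phi>_\<gamma>)
  define G where "G = inf (nhds z) (principal (gph F)) \<times>\<^sub>F at_right (0::real)"
  let ?Q = "difference_quotient (gph F)"
  have "G \<noteq> bot"
    unfolding G_def using z(2) by (rule graph_quotient_filter_neq_bot)
  have fst_G: "filterlim fst (inf (nhds z) (principal (gph F))) G"
    unfolding G_def by (rule filterlim_fst)
  have snd_G: "filterlim snd (at_right 0) G"
    unfolding G_def by (rule filterlim_snd)
  have fst_lim: "(fst \<longlongrightarrow> z) G"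
    by (rule filterlim_mono[OF fst_G inf_le1 order_refl])
  have snd_lim: "(snd \<longlongrightarrow> 0) G"
    by (rule filterlim_mono[OF snd_G at_within_le_nhds order_refl])
  have fst_gph: "\<forall>\<^sub>F s in G. fst s \<in> gph F"
    by (rule eventually_compose_filterlim[OF _ fst_G]) (simp add: eventually_inf_principal)
  have snd_pos: "\<forall>\<^sub>F s in G. 0 < snd s"
    by (rule eventually_compose_filterlim[OF _ snd_G]) (simp add: eventually_at_right_less)
  have cont_\<Phi>: "isCont \<Phi> z"
    using \<Phi>_deriv[OF z(1)] by (rule has_derivative_continuous)
  have "PK_upper_limit G ?Q \<subseteq> range (para u A)"
  proof
    fix w assume w: "w \<in> PK_upper_limit G ?Q"
    have "\<exists>s p. fst s \<in> gph F \<and> 0 < snd s \<and> dist (fst s) z < inverse (real (Suc k)) \<and> snd s < inverse (real (Suc k))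
        \<and> p \<in> gph F \<and> dist w ((p - fst s) /\<^sub>R snd s) < inverse (real (Suc k))" for k
    proof -
      have "0 < inverse (real (Suc k))"
        by simp
      note tendstoD[OF fst_lim this] order_tendstoD(2)[OF snd_lim this]
      then have "\<forall>\<^sub>F s in G. fst s \<in> gph F \<and> 0 < snd s \<and> dist (fst s) z < inverse (real (Suc k)) \<and> snd s < inverse (real (Suc k))"
        using fst_gph snd_pos by eventually_elim blast
      from frequently_eventually_frequently[OF PK_upper_limit_frequently[OF w \<open>0 < inverse (real (Suc k))\<close>] this]
      obtain s where s: "infdist w (?Q s) < inverse (real (Suc k))" "fst s \<in> gph F" "0 < snd s"
          "dist (fst s) z < inverse (real (Suc k))" "snd s < inverse (real (Suc k))"
        by (auto dest: frequently_ex)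
      \<comment> \<open>The base point lies in the graph, so 0 is a quotient and
        \<open>infdist\<close> is a true infimum.\<close>
      have "?Q s \<noteq> {}"
        using s(2) by (auto simp: difference_quotient_def split_beta)
      then obtain q where "q \<in> ?Q s" "dist w q < inverse (real (Suc k))"
        using s(1) infdist_lessE by blast
      then obtain p where "p \<in> gph F" "dist w ((p - fst s) /\<^sub>R snd s) < inverse (real (Suc k))"
        unfolding difference_quotient_def split_beta by blast
      then show ?thesis
        using s by blast
    qed
    then obtain s p where s: "\<And>k. fst (s k) \<in> gph F" "\<And>k. 0 < snd (s k)"
        "\<And>k. dist (fst (s k)) z < inverse (real (Suc k))" "\<And>k. snd (s k) < inverse (real (Suc k))"
      and p: "\<And>k. p k \<in> gph F" "\<And>k. dist w ((p k - fst (s k)) /\<^sub>R snd (s k)) < inverse (real (Suc k))"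
      by metis
    define x t q where "x k = fst (s k)" and "t k = snd (s k)" and "q k = (p k - x k) /\<^sub>R t k" for k
    have x: "x \<longlonglongrightarrow> z"
      using s(3) unfolding x_def by (rule LIMSEQ_if_dist_less_inverse_Suc)
    have t: "t \<longlonglongrightarrow> 0"
      using s(2,4) by (intro LIMSEQ_if_dist_less_inverse_Suc) (simp add: t_def less_imp_le)
    have q: "q \<longlonglongrightarrow> w"
      using p(2) by (intro LIMSEQ_if_dist_less_inverse_Suc) (simp add: q_def x_def t_def dist_commute)
    have "p = (\<lambda>k. x k + t k *\<^sub>R q k)"
    proof
      fix k
      have "t k \<noteq> 0"
        using s(2)[of k] by (simp add: t_def)
      then show "p k = x k + t k *\<^sub>R q k"
        by (simp add: q_def)
    qed
    then have p_lim: "p \<longlonglongrightarrow> z"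
      using tendsto_add[OF x tendsto_scaleR[OF t q]] by simp
    have q': "(\<lambda>k. (p k - x k) /\<^sub>R t k) \<longlonglongrightarrow> w"
      using q by (simp add: q_def[abs_def])
    have lim: "(\<lambda>k. (\<Phi> (p k) - \<Phi> (x k)) /\<^sub>R t k) \<longlonglongrightarrow> \<Phi>' z w"
      by (rule tendsto_strict_difference_quotient[OF \<Phi>_strict[OF z(1)] x p_lim q'])
    have \<Phi>_lim: "(\<lambda>k. fst (\<Phi> (x k))) \<longlonglongrightarrow> u" "(\<lambda>k. fst (\<Phi> (p k))) \<longlonglongrightarrow> u"
      using tendsto_fst[OF isCont_tendsto_compose[OF cont_\<Phi> x]]
        tendsto_fst[OF isCont_tendsto_compose[OF cont_\<Phi> p_lim]] z(3) by simp_all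
    have fst_q: "(\<lambda>k. (fst (\<Phi> (p k)) - fst (\<Phi> (x k))) /\<^sub>R t k) \<longlonglongrightarrow> fst (\<Phi>' z w)"
      using tendsto_fst[OF lim] by simp
    have "(\<lambda>k. (f (fst (\<Phi> (p k))) - f (fst (\<Phi> (x k)))) /\<^sub>R t k) \<longlonglongrightarrow> A (fst (\<Phi>' z w))"
      by (rule tendsto_strict_difference_quotient[OF f \<Phi>_lim fst_q])
    \<comment> \<open>The same quotients computed twice: via the strict derivative of
      \<open>f\<close>, and as second components of the quotients of \<Phi>, since eventually both
      points lie in \<open>W\<close> and on the graph.\<close>
    moreover have "(\<lambda>k. (f (fst (\<Phi> (p k))) - f (fst (\<Phi> (x k)))) /\<^sub>R t k) \<longlonglongrightarrow> snd (\<Phi>' z w)"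
    proof (rule Lim_transform_eventually[OF tendsto_snd[OF lim]])
      have "\<forall>\<^sub>F k in sequentially. x k \<in> W" "\<forall>\<^sub>F k in sequentially. p k \<in> W"
        using topological_tendstoD[OF x open_W z(1)] topological_tendstoD[OF p_lim open_W z(1)] by auto
      then show "\<forall>\<^sub>F k in sequentially. snd ((\<Phi> (p k) - \<Phi> (x k)) /\<^sub>R t k)
          = (f (fst (\<Phi> (p k))) - f (fst (\<Phi> (x k)))) /\<^sub>R t k"
      proof eventually_elim
        case (elim k)
        then show ?case
          using gph_iff[of "x k"] gph_iff[of "p k"] s(1)[of k] p(1)[of k] by (simp add: x_def)
      qed
    qed
    ultimately have "A (fst (\<Phi>' z w)) = snd (\<Phi>' z w)"
      by (rule LIMSEQ_unique)
    then have "para u A (fst (\<Phi>' z w)) = w"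
      using \<Psi>'_\<Phi>'[OF z(1), of w] z(3) by (simp add: para_apply)
    then show "w \<in> range (para u A)"
      by (metis rangeI)
  qed
  moreover have "range (para u A) \<subseteq> PK_lower_limit G ?Q"
  proof
    fix w assume "w \<in> range (para u A)"
    then obtain a where a: "w = \<Psi>' (u, f u) (a, A a)"
      by (auto simp: para_apply)
    \<comment> \<open>The parameter of the moving base point and its shift by \<open>t\<close> times
      \<open>a\<close>; their difference quotient is exactly \<open>a\<close>.\<close>
    define u' v' where "u' s = fst (\<Phi> (fst s))" and "v' s = u' s + snd s *\<^sub>R a" for s :: "('a \<times> 'b) \<times> real"
    have u': "(u' \<longlongrightarrow> u) G"
      unfolding u'_def using tendsto_fst[OF isCont_tendsto_compose[OF cont_\<Phi> fst_lim]] z(3) by simp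
    have v': "(v' \<longlongrightarrow> u) G"
      unfolding v'_def using tendsto_add[OF u' tendsto_scaleR[OF snd_lim tendsto_const[of a]]] by simp
    have quot: "((\<lambda>s. (v' s - u' s) /\<^sub>R snd s) \<longlongrightarrow> a) G"
    proof (rule tendsto_eventually)
      show "\<forall>\<^sub>F s in G. (v' s - u' s) /\<^sub>R snd s = a"
        using snd_pos by eventually_elim (simp add: v'_def)
    qed
    have "isCont f u"
      using f_continuous open_U u by (simp add: continuous_on_eq_continuous_at)
    then have f_lim: "((\<lambda>s. f (u' s)) \<longlongrightarrow> f u) G" "((\<lambda>s. f (v' s)) \<longlongrightarrow> f u) G"
      using u' v' by (auto intro: isCont_tendsto_compose)
    have "((\<lambda>s. ((v' s, f (v' s)) - (u' s, f (u' s))) /\<^sub>R snd s) \<longlongrightarrow> (a, A a)) G"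
      using tendsto_Pair[OF quot tendsto_strict_difference_quotient[OF f u' v' quot]] by simp
    then have "((\<lambda>s. (\<gamma> (v' s) - \<gamma> (u' s)) /\<^sub>R snd s) \<longlongrightarrow> w) G"
      unfolding a \<gamma>_def
      by (intro tendsto_strict_difference_quotient[OF \<Psi>_strict[OF graph_in_V[OF u]]] tendsto_Pair u' v' f_lim)
    then have "((\<lambda>s. dist w ((\<gamma> (v' s) - \<gamma> (u' s)) /\<^sub>R snd s)) \<longlongrightarrow> dist w w) G"
      by (intro tendsto_dist tendsto_const)
    then have lim: "((\<lambda>s. dist w ((\<gamma> (v' s) - \<gamma> (u' s)) /\<^sub>R snd s)) \<longlongrightarrow> 0) G"
      by simp
    have "\<forall>\<^sub>F s in G. fst s \<in> W" "\<forall>\<^sub>F s in G. v' s \<in> U"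
      using topological_tendstoD[OF fst_lim open_W z(1)] topological_tendstoD[OF v' open_U u] by auto
    then have "\<forall>\<^sub>F s in G. norm (infdist w (?Q s)) \<le> dist w ((\<gamma> (v' s) - \<gamma> (u' s)) /\<^sub>R snd s)"
      using fst_gph
    proof eventually_elim
      case (elim s)
      then have "\<gamma> (u' s) = fst s"
        by (simp add: u'_def \<gamma>_fst_\<Phi>)
      then have "(\<gamma> (v' s) - \<gamma> (u' s)) /\<^sub>R snd s \<in> ?Q s"
        using \<gamma>_gph[OF elim(2)] by (simp add: difference_quotient_def split_beta image_eqI[of _ _ "\<gamma> (v' s)"])
      from infdist_le[OF this, of w] show ?case
        by (simp add: infdist_nonneg)
    qed
    then have "((\<lambda>s. infdist w (?Q s)) \<longlongrightarrow> 0) G"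
      using lim by (rule Lim_null_comparison)
    then show "w \<in> PK_lower_limit G ?Q"
      by (rule PK_lower_limitI[OF \<open>G \<noteq> bot\<close>])
  qed
  ultimately have "PK_upper_limit G ?Q = PK_lower_limit G ?Q"
    using PK_lower_limit_subset_upper_limit[OF \<open>G \<noteq> bot\<close>, of ?Q] by blast
  then show ?thesis
    unfolding strictly_proto_differentiable_def using z(2) by (simp add: G_def z_def Let_def)
qed

text \<open>The exceptional points in a small neighbourhood are the image under
  \<open>\<gamma>\<close> of parameters at which \<open>B\<close> is not a singleton. These form a
  null set, and \<open>\<gamma>\<close> is Lipschitz there.\<close>

theorem hausdorff_null_nonstrict_points:
  assumes zbar: "zbar \<in> W" and ss: "SCD_ss_star_around F zbar"
  shows "\<exists>W0. open W0 \<and> zbar \<in> W0 \<and> hausdorff_measure DIM('d)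
    {z \<in> gph F \<inter> W0. \<not> (strictly_proto_differentiable F z \<and> is_singleton (SC_derivative F z))} = 0"
proof -
  define bad where "bad z \<longleftrightarrow> \<not> (strictly_proto_differentiable F z \<and> is_singleton (SC_derivative F z))" for z
  obtain N where N: "zbar \<in> gph F" "open N" "zbar \<in> N" "\<And>z. z \<in> gph F \<inter> N \<Longrightarrow> SCD_ss_star_at F z"
    using ss unfolding SCD_ss_star_around_def by blast
  \<comment> \<open>The ball serves twice: \<Psi> is Lipschitz on it, and its projection makes the
    parameter set bounded.\<close>
  obtain r K where r: "r > 0" and lip: "K-lipschitz_on (ball (\<Phi> zbar) r) \<Psi>"
    using strictly_differentiable_imp_lipschitz_on_ball[OF \<Psi>_strict[OF \<Phi>_V[OF zbar]]] by metis
  define U0 where "U0 = {u \<in> U. (u, f u) \<in> ball (\<Phi> zbar) r \<and> \<gamma> u \<in> N}"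
  define W0 where "W0 = {z \<in> W. \<Phi> z \<in> ball (\<Phi> zbar) r} \<inter> N"
  have "continuous_on W \<Phi>"
    by (intro continuous_at_imp_continuous_on ballI has_derivative_continuous[OF \<Phi>_deriv])
  from continuous_open_preimage[OF this open_W open_ball]
  have "open (W \<inter> \<Phi> -` ball (\<Phi> zbar) r \<inter> N)"
    using N(2) by blast
  moreover have "W0 = W \<inter> \<Phi> -` ball (\<Phi> zbar) r \<inter> N"
    by (auto simp: W0_def)
  ultimately have "open W0"
    by simp
  have "zbar \<in> W0"
    using zbar N(3) r by (simp add: W0_def)
  have "open (U \<inter> (\<lambda>u. (u, f u)) -` ball (\<Phi> zbar) r)" "open (U \<inter> \<gamma> -` N)"
    by (intro continuous_open_preimage continuous_on_Pair continuous_on_id f_continuous \<gamma>_continuous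
        open_U open_ball N(2))+
  moreover have "U0 = (U \<inter> (\<lambda>u. (u, f u)) -` ball (\<Phi> zbar) r) \<inter> (U \<inter> \<gamma> -` N)"
    by (auto simp: U0_def)
  ultimately have "open U0"
    by auto
  have U0: "u \<in> U" "SCD_ss_star_at F (\<gamma> u)" if "u \<in> U0" for u
    using that N(4) \<gamma>_gph by (auto simp: U0_def)
  \<comment> \<open>On \<open>U0\<close> the SCD-ss* property holds at every
    \<open>\<gamma> u\<close>, which gives nonemptiness of \<open>B\<close> and
    semismoothness.\<close>
  interpret semismooth_selection U0 f B C
  proof
    show "B u \<noteq> {}" if "u \<in> U0" for u
    proof -
      have "SC_adjoint F (\<gamma> u) \<noteq> {}"
        using U0(2)[OF that] by (auto simp: SCD_ss_star_at_def)
      then obtain L where "L \<in> SC_derivative F (\<gamma> u)"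
        by (auto simp: SC_adjoint_def)
      then show ?thesis
        using SC_derivative_eq_range_para[OF U0(1)[OF that]] by blast
    qed
    show "A \<in> B u" if "\<And>k. v k \<in> U0" "v \<longlonglongrightarrow> u" "u \<in> U0" "\<And>k. G k \<in> B (v k)" "G \<longlonglongrightarrow> A" for v u G A
      using that U0(1) by (intro B_closed_graph[of v u G A]) auto
    show "\<exists>\<delta>>0. \<forall>v\<in>U0. norm (v - u) < \<delta> \<longrightarrow> (\<forall>A\<in>B v. norm (f v - f u - A (v - u)) \<le> \<epsilon> * norm (v - u))"
      if "u \<in> U0" "0 < \<epsilon>" for u \<epsilon>
      using B_semismooth[OF U0[OF that(1)] that(2)] U0(1) by meson
  qed (use \<open>open U0\<close> norm_B_le U0(1) in auto)
  define S where "S = {u \<in> U0. bad (\<gamma> u)}"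
  have "S \<subseteq> {u \<in> U0. \<not> is_singleton (B u)}"
  proof
    fix u assume u: "u \<in> S"
    have "\<not> bad (\<gamma> u)" if "is_singleton (B u)"
    proof -
      from that obtain A where A: "B u = {A}"
        by (auto simp: is_singleton_def)
      have "u \<in> U0" "u \<in> U"
        using u U0(1) by (auto simp: S_def)
      have "strictly_differentiable f A u"
        unfolding strictly_differentiable_def
        using strict_derivative_at_singleton[OF \<open>u \<in> U0\<close> A] by blast
      then have "strictly_proto_differentiable F (\<gamma> u)"
        using \<open>u \<in> U\<close> strictly_proto_differentiable_if_strictly_differentiable by blast
      moreover have "SC_derivative F (\<gamma> u) = {range (para u A)}"
      proof
        show "SC_derivative F (\<gamma> u) \<subseteq> {range (para u A)}"
          using SC_derivative_eq_range_para[OF \<open>u \<in> U\<close>] A by (metis singleton_iff subsetI)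
        show "{range (para u A)} \<subseteq> SC_derivative F (\<gamma> u)"
          using A by (auto simp: B_def)
      qed
      ultimately show ?thesis
        by (simp add: bad_def)
    qed
    then show "u \<in> {u \<in> U0. \<not> is_singleton (B u)}"
      using u by (auto simp: S_def)
  qed
  then have "negligible S"
    using negligible_not_singleton negligible_subset by blast
  have in_ball: "(u, f u) \<in> ball (\<Phi> zbar) r" if "u \<in> S" for u
    using that by (auto simp: S_def U0_def)
  have "fst ` ball (\<Phi> zbar) r \<supseteq> S"
    using in_ball by force
  then have "bounded S"
    using bounded_subset[OF bounded_fst[OF bounded_ball]] by blast
  have "(K * (1 + C))-lipschitz_on S \<gamma>"
  proof (rule lipschitz_onI)
    fix u v assume uv: "u \<in> S" "v \<in> S"
    have "dist (f u) (f v) \<le> C * dist u v"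
      using uv U0(1) by (intro lipschitz_onD[OF f_lipschitz]) (auto simp: S_def)
    then have le: "dist (u, f u) (v, f v) \<le> (1 + C) * dist u v"
      using norm_Pair_le[of "u - v" "f u - f v"] by (simp add: dist_norm algebra_simps)
    have "dist (\<gamma> u) (\<gamma> v) \<le> K * dist (u, f u) (v, f v)"
      unfolding \<gamma>_def using uv in_ball by (intro lipschitz_onD[OF lip])
    also have "\<dots> \<le> K * ((1 + C) * dist u v)"
      using le lipschitz_on_nonneg[OF lip] by (rule mult_left_mono)
    finally show "dist (\<gamma> u) (\<gamma> v) \<le> K * (1 + C) * dist u v"
      by (simp add: mult.assoc)
  qed (use lipschitz_on_nonneg[OF lip] C_nonneg in auto)
  from hausdorff_measure_lipschitz_image_negligible[OF \<open>negligible S\<close> \<open>bounded S\<close> this]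
  have "hausdorff_measure DIM('d) (\<gamma> ` S) = 0" .
  \<comment> \<open>\<open>U0\<close> and \<open>W0\<close> are cut out by the same two conditions,
    so \<open>\<gamma>\<close> matches their exceptional points.\<close>
  moreover have "{z \<in> gph F \<inter> W0. bad z} = \<gamma> ` S"
  proof
    show "{z \<in> gph F \<inter> W0. bad z} \<subseteq> \<gamma> ` S"
    proof
      fix z assume z: "z \<in> {z \<in> gph F \<inter> W0. bad z}"
      then have *: "z \<in> W" "z \<in> gph F"
        by (auto simp: W0_def)
      have "(fst (\<Phi> z), f (fst (\<Phi> z))) = \<Phi> z" "fst (\<Phi> z) \<in> U"
        using gph_iff[OF *(1)] *(2) by (simp_all add: prod_eq_iff)
      then have "fst (\<Phi> z) \<in> S"
        using z \<gamma>_fst_\<Phi>[OF *(2,1)] by (simp add: S_def U0_def W0_def)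
      then show "z \<in> \<gamma> ` S"
        using \<gamma>_fst_\<Phi>[OF *(2,1)] by (metis imageI)
    qed
    show "\<gamma> ` S \<subseteq> {z \<in> gph F \<inter> W0. bad z}"
      by (auto simp: S_def U0_def W0_def \<gamma>_gph \<gamma>_W \<Phi>_\<gamma>)
  qed
  ultimately show ?thesis
    using \<open>open W0\<close> \<open>zbar \<in> W0\<close> unfolding bad_def by (intro exI[of _ W0]) simp
qed

end

theorem corollary4p3:
  fixes F :: "real ^ 'n \<Rightarrow> (real ^ 'm) set"
    and xbar :: "real ^ 'n" and ybar :: "real ^ 'm"
  assumes "(xbar, ybar) \<in> gph F"
    and "graphically_lipschitzian TYPE((real ^ 'n) \<times> (real ^ 'm)) F (xbar, ybar)"
    and "SCD_ss_star_around F (xbar, ybar)"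
  shows "\<exists>W. open W \<and> (xbar, ybar) \<in> W \<and>
           hausdorff_measure CARD('n)
             {z \<in> gph F \<inter> W.
                \<not> (strictly_proto_differentiable F z \<and> is_singleton (SC_derivative F z))} = 0"
proof -
  obtain W and \<Phi> :: "(real ^ 'n) \<times> (real ^ 'm) \<Rightarrow> (real ^ 'n) \<times> (real ^ 'm)" and U f C
    where W: "open W" "(xbar, ybar) \<in> W" "inj_on \<Phi> W" "open (\<Phi> ` W)"
      and C1: "continuously_differentiable_on \<Phi> W" "continuously_differentiable_on (inv_into W \<Phi>) (\<Phi> ` W)"
      and f: "open U" "C-lipschitz_on U f" "\<Phi> ` (gph F \<inter> W) = {(u, f u) |u. u \<in> U}"
    using assms(2) unfolding graphically_lipschitzian_def by blast
  obtain \<Phi>' where \<Phi>': "\<forall>z\<in>W. (\<Phi> has_derivative blinfun_apply (\<Phi>' z)) (at z)" "continuous_on W \<Phi>'"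
    using C1(1) unfolding continuously_differentiable_on_def by blast
  obtain \<Psi>' where \<Psi>': "\<forall>p\<in>\<Phi> ` W. (inv_into W \<Phi> has_derivative blinfun_apply (\<Psi>' p)) (at p)" "continuous_on (\<Phi> ` W) \<Psi>'"
    using C1(2) unfolding continuously_differentiable_on_def by blast
  \<comment> \<open>The first factor \<open>real ^ 'n\<close> of the chart target fixes the
    dimension of the graph as n.\<close>
  interpret graph_chart F \<Phi> \<Phi>' W "inv_into W \<Phi>" \<Psi>' "\<Phi> ` W" f U C
    using W f \<Phi>' \<Psi>' by unfold_locales (auto simp: inv_into_into f_inv_into_f)
  show ?thesis
    using hausdorff_null_nonstrict_points[OF W(2) assms(3)] by simp
qed

end
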